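(* Let $I$ be a finite index set, let $\mathcal{A}_i$ ($i\in I$) be arbitrary unital C*-algebras, and let $\mathcal{A}=\bigotimes_{i\in I}\mathcal{A}_i$ (minimal C*-tensor product). Then for any $\phi\in M^0(\mathcal{A})$, $$\|\phi\|_{qH}=\inf\Big\{\sum_{i}\|\phi_i\|_i : \phi_i\in\tilde{\mathcal{A}}_i^{\perp}\ (i\in I)\ \text{ and }\ \phi=\sum_i\phi_i\Big\}.$$
   Context: For each $i\in I$, $\tilde{\mathcal{A}}_i=\bigotimes\{\mathcal{A}_j:j\neq i\}$, viewed as a unital C*-subalgebra of $\mathcal{A}$ in the evident way (with $1_{\mathcal{A}_i}$ in position $i$; it is $\mathbb{C}1_{\mathcal{A}}$ if $|I|=1$). Define seminorms on $\mathcal{A}$ by $$L_i(a)=2\inf\{\|a-c\|: c\in\tilde{\mathcal{A}}_i\},\qquad L_{qH}(a)=\max\{L_i(a): i\in I\}$$ ($L_{qH}$ is the quantum Hamming seminorm). $M^0(\mathcal{A})$ is the space of continuous linear functionals on $\mathcal{A}$ that vanish on $\mathbb{C}1_{\mathcal{A}}$. For $\phi\in M^0(\mathcal{A})$, $\|\phi\|_{qH}=\sup\{|\phi(a)|: a\in\mathcal{A},\ L_{qH}(a)\leq 1\}$. $\tilde{\mathcal{A}}_i^{\perp}$ is the subspace of $M^0(\mathcal{A})$ of functionals vanishing on $\tilde{\mathcal{A}}_i$, identified with the dual of $\mathcal{A}/\tilde{\mathcal{A}}_i$, and $\|\cdot\|_i$ is the norm on it dual to $L_i$ regarded as a norm on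 $\mathcal{A}/\tilde{\mathcal{A}}_i$, that is $\|\psi\|_i=\sup\{|\psi(a)|: a\in\mathcal{A},\ L_i(a)\leq 1\}$. *)

theory Defs
  imports "HOL-Analysis.Analysis" "HOL-Algebra.Algebra" "HOL-Algebra.Algebraic_Closure_Type"
begin

text \<open>
  The members of a family \<open>(A\<^sub>i)\<close> of C*-algebras have different underlying sets, so all structures
  are carrier-based, extending the module record of the algebra library.  Any family of algebras can
  be placed on subsets of one common type.
\<close>

abbreviation complex_ring :: "complex ring"
  where "complex_ring \<equiv> ring_of_type_algebra"

subsection \<open>Normed spaces on a carrier\<close>

text \<open>
  The locale \<^locale>\<open>Metric_space\<close> demands nonnegativity and symmetry on the whole type, hence the
  value 0 off the carrier.
\<close>

definition norm_dist :: "('c, 'a, 'm) module_scheme \<Rightarrow> ('a \<Rightarrow> real) \<Rightarrow> 'a \<Rightarrow> 'a \<Rightarrow> real"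
  where "norm_dist M nrm x y =
    (if x \<in> carrier M \<and> y \<in> carrier M then nrm (x \<ominus>\<^bsub>M\<^esub> y) else 0)"

abbreviation norm_topology :: "('c, 'a, 'm) module_scheme \<Rightarrow> ('a \<Rightarrow> real) \<Rightarrow> 'a topology"
  where "norm_topology M nrm \<equiv> Metric_space.mtopology (carrier M) (norm_dist M nrm)"

locale complex_normed_space = module complex_ring M
  for M :: "(complex, 'a, 'm) module_scheme" (structure) and nrm :: "'a \<Rightarrow> real" +
  assumes nrm_nonneg: "x \<in> carrier M \<Longrightarrow> 0 \<le> nrm x"
    and nrm_eq_0_iff: "x \<in> carrier M \<Longrightarrow> nrm x = 0 \<longleftrightarrow> x = \<zero>"
    and nrm_triangle: "\<lbrakk>x \<in> carrier M; y \<in> carrier M\<rbrakk> \<Longrightarrow> nrm (x \<oplus> y) \<le> nrm x + nrm y"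
    and nrm_smult: "x \<in> carrier M \<Longrightarrow> nrm (c \<odot> x) = cmod c * nrm x"
begin

lemma Metric_space_norm_dist: "Metric_space (carrier M) (norm_dist M nrm)"
proof -
  have minus: "nrm (x \<ominus> y) = nrm (y \<ominus> x)" if "x \<in> carrier M" "y \<in> carrier M" for x y
  proof -
    have m1: "- 1 \<in> carrier complex_ring" "1 \<in> carrier complex_ring"
      by (simp_all add: ring_of_type_algebra_def)
    have "(- 1) \<odot> (y \<ominus> x) = (\<ominus>\<^bsub>complex_ring\<^esub> \<one>\<^bsub>complex_ring\<^esub>) \<odot> (y \<ominus> x)"
    proof -
      have "\<ominus>\<^bsub>complex_ring\<^esub> \<one>\<^bsub>complex_ring\<^esub> = - 1"
        by (rule R.sum_zero_eq_neg[symmetric])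
           (simp_all add: ring_of_type_algebra_def)
      then show ?thesis by simp
    qed
    also have "\<dots> = \<ominus> (y \<ominus> x)"
      using that by (simp add: smult_l_minus)
    also have "\<dots> = x \<ominus> y"
      using that by (simp add: a_minus_def M.minus_add M.a_comm)
    finally show ?thesis
      using nrm_smult[of "y \<ominus> x" "- 1"] that by simp
  qed
  show ?thesis
  proof
    fix x y show "0 \<le> norm_dist M nrm x y"
      by (auto simp: norm_dist_def intro!: nrm_nonneg)
    show "norm_dist M nrm x y = norm_dist M nrm y x"
      by (auto simp: norm_dist_def minus)
  next
    fix x y assume *: "x \<in> carrier M" "y \<in> carrier M"
    have "x = y" if "x \<ominus> y = \<zero>"
    proof -
      have "x = (x \<ominus> y) \<oplus> y"
        using * by (simp add: a_minus_def M.a_assoc M.l_neg)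
      then show ?thesis using that * by simp
    qed
    moreover have "y \<ominus> y = \<zero>"
      using * by (simp add: a_minus_def M.r_neg)
    ultimately show "norm_dist M nrm x y = 0 \<longleftrightarrow> x = y"
      using * by (auto simp: norm_dist_def nrm_eq_0_iff)
  next
    fix x y z assume *: "x \<in> carrier M" "y \<in> carrier M" "z \<in> carrier M"
    then have "x \<ominus> z = (x \<ominus> y) \<oplus> (y \<ominus> z)"
      by (simp add: a_minus_def M.a_assoc M.r_neg1)
    then show "norm_dist M nrm x z \<le> norm_dist M nrm x y + norm_dist M nrm y z"
      using * nrm_triangle[of "x \<ominus> y" "y \<ominus> z"] by (simp add: norm_dist_def)
  qed
qed

end

definition closed_span :: "(complex, 'a, 'm) module_scheme \<Rightarrow> ('a \<Rightarrow> real) \<Rightarrow> 'a set \<Rightarrow> 'a set"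
  where "closed_span M nrm S =
    norm_topology M nrm closure_of ((\<lambda>N. submodule N complex_ring M) hull S)"

subsection \<open>Unital C*-algebras\<close>

record 'a cstar = "(complex, 'a) module" +
  star :: "'a \<Rightarrow> 'a"
  cnorm :: "'a \<Rightarrow> real"

locale unital_cstar_algebra = complex_normed_space A "cnorm A" + A?: ring A
  for A :: "'a cstar" (structure) +
  assumes smult_mult_left:
      "\<lbrakk>x \<in> carrier A; y \<in> carrier A\<rbrakk> \<Longrightarrow> (c \<odot> x) \<otimes> y = c \<odot> (x \<otimes> y)"
    and smult_mult_right:
      "\<lbrakk>x \<in> carrier A; y \<in> carrier A\<rbrakk> \<Longrightarrow> x \<otimes> (c \<odot> y) = c \<odot> (x \<otimes> y)"
    and star_closed: "x \<in> carrier A \<Longrightarrow> star A x \<in> carrier A"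
    and star_star: "x \<in> carrier A \<Longrightarrow> star A (star A x) = x"
    and star_add: "\<lbrakk>x \<in> carrier A; y \<in> carrier A\<rbrakk> \<Longrightarrow> star A (x \<oplus> y) = star A x \<oplus> star A y"
    and star_smult: "x \<in> carrier A \<Longrightarrow> star A (c \<odot> x) = cnj c \<odot> star A x"
    and star_mult: "\<lbrakk>x \<in> carrier A; y \<in> carrier A\<rbrakk> \<Longrightarrow> star A (x \<otimes> y) = star A y \<otimes> star A x"
    and cnorm_mult: "\<lbrakk>x \<in> carrier A; y \<in> carrier A\<rbrakk> \<Longrightarrow> cnorm A (x \<otimes> y) \<le> cnorm A x * cnorm A y"
    and cstar_identity: "x \<in> carrier A \<Longrightarrow> cnorm A (star A x \<otimes> x) = (cnorm A x)\<^sup>2"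
    and complete: "Metric_space.mcomplete (carrier A) (norm_dist A (cnorm A))"

subsection \<open>Hilbert spaces, bounded operators, representations\<close>

record 'h hilbert = "(complex, 'h) module" +
  inner_prod :: "'h \<Rightarrow> 'h \<Rightarrow> complex"

definition hnorm :: "'h hilbert \<Rightarrow> 'h \<Rightarrow> real"
  where "hnorm H x = sqrt (Re (inner_prod H x x))"

locale hilbert_space = module complex_ring H for H :: "'h hilbert" (structure) +
  assumes inner_prod_add_left:
      "\<lbrakk>x \<in> carrier H; y \<in> carrier H; z \<in> carrier H\<rbrakk> \<Longrightarrow>
       inner_prod H (x \<oplus> y) z = inner_prod H x z + inner_prod H y z"
    and inner_prod_smult_left:
      "\<lbrakk>x \<in> carrier H; y \<in> carrier H\<rbrakk> \<Longrightarrow> inner_prod H (c \<odot> x) y = c * inner_prod H x y"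
    and inner_prod_commute:
      "\<lbrakk>x \<in> carrier H; y \<in> carrier H\<rbrakk> \<Longrightarrow> inner_prod H y x = cnj (inner_prod H x y)"
    and inner_prod_nonneg: "x \<in> carrier H \<Longrightarrow> 0 \<le> Re (inner_prod H x x)"
    and inner_prod_eq_0: "\<lbrakk>x \<in> carrier H; inner_prod H x x = 0\<rbrakk> \<Longrightarrow> x = \<zero>"
    and complete: "Metric_space.mcomplete (carrier H) (norm_dist H (hnorm H))"

definition bounded_operator :: "'h hilbert \<Rightarrow> ('h \<Rightarrow> 'h) \<Rightarrow> bool"
  where "bounded_operator H T \<longleftrightarrow>
    T \<in> carrier H \<rightarrow> carrier H \<and>
    (\<forall>x\<in>carrier H. \<forall>y\<in>carrier H. T (x \<oplus>\<^bsub>H\<^esub> y) = T x \<oplus>\<^bsub>H\<^esub> T y) \<and>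
    (\<forall>c. \<forall>x\<in>carrier H. T (c \<odot>\<^bsub>H\<^esub> x) = c \<odot>\<^bsub>H\<^esub> T x) \<and>
    (\<exists>C. \<forall>x\<in>carrier H. hnorm H (T x) \<le> C * hnorm H x)"

definition operator_norm :: "'h hilbert \<Rightarrow> ('h \<Rightarrow> 'h) \<Rightarrow> real"
  where "operator_norm H T = (SUP x\<in>{x \<in> carrier H. hnorm H x \<le> 1}. hnorm H (T x))"

definition star_representation :: "'a cstar \<Rightarrow> 'h hilbert \<Rightarrow> ('a \<Rightarrow> 'h \<Rightarrow> 'h) \<Rightarrow> bool"
  where "star_representation A H \<pi> \<longleftrightarrow>
    (\<forall>a\<in>carrier A. bounded_operator H (\<pi> a)) \<and>
    (\<forall>a\<in>carrier A. \<forall>b\<in>carrier A. \<forall>x\<in>carrier H. \<pi> (a \<oplus>\<^bsub>A\<^esub> b) x = \<pi> a x \<oplus>\<^bsub>H\<^esub> \<pi> b x) \<and>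
    (\<forall>c. \<forall>a\<in>carrier A. \<forall>x\<in>carrier H. \<pi> (c \<odot>\<^bsub>A\<^esub> a) x = c \<odot>\<^bsub>H\<^esub> \<pi> a x) \<and>
    (\<forall>a\<in>carrier A. \<forall>b\<in>carrier A. \<forall>x\<in>carrier H. \<pi> (a \<otimes>\<^bsub>A\<^esub> b) x = \<pi> a (\<pi> b x)) \<and>
    (\<forall>x\<in>carrier H. \<pi> \<one>\<^bsub>A\<^esub> x = x) \<and>
    (\<forall>a\<in>carrier A. \<forall>x\<in>carrier H. \<forall>y\<in>carrier H.
       inner_prod H (\<pi> (star A a) x) y = inner_prod H x (\<pi> a y))"

definition faithful_representation :: "'a cstar \<Rightarrow> 'h hilbert \<Rightarrow> ('a \<Rightarrow> 'h \<Rightarrow> 'h) \<Rightarrow> bool"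
  where "faithful_representation A H \<pi> \<longleftrightarrow> star_representation A H \<pi> \<and>
    (\<forall>a\<in>carrier A. (\<forall>x\<in>carrier H. \<pi> a x = \<zero>\<^bsub>H\<^esub>) \<longrightarrow> a = \<zero>\<^bsub>A\<^esub>)"

subsection \<open>Tensor products\<close>

text \<open>
  \<open>K\<close> is the Hilbert space tensor product of the \<open>H\<^sub>i\<close>, with \<open>t \<xi>\<close> the elementary tensor of the
  family \<open>\<xi>\<close>.  Multilinearity of \<open>t\<close> follows from the formula for inner products.
\<close>

definition hilbert_tensor_product ::
    "'i set \<Rightarrow> ('i \<Rightarrow> 'h hilbert) \<Rightarrow> 'k hilbert \<Rightarrow> (('i \<Rightarrow> 'h) \<Rightarrow> 'k) \<Rightarrow> bool"
  where "hilbert_tensor_product I H K t \<longleftrightarrow>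
    hilbert_space K \<and>
    t \<in> (\<Pi>\<^sub>E i\<in>I. carrier (H i)) \<rightarrow> carrier K \<and>
    (\<forall>\<xi>\<in>\<Pi>\<^sub>E i\<in>I. carrier (H i). \<forall>\<eta>\<in>\<Pi>\<^sub>E i\<in>I. carrier (H i).
       inner_prod K (t \<xi>) (t \<eta>) = (\<Prod>i\<in>I. inner_prod (H i) (\<xi> i) (\<eta> i))) \<and>
    closed_span K (hnorm K) (t ` (\<Pi>\<^sub>E i\<in>I. carrier (H i))) = carrier K"

text \<open>
  The minimal (spatial) tensor product: \<open>T\<close>, with elementary tensors \<open>tens a\<close>, is isometrically
  *-isomorphic to the norm closure of the algebraic tensor product of the \<open>A\<^sub>i\<close> acting on the tensor
  product of Hilbert spaces \<open>H\<^sub>i\<close> on which the \<open>A\<^sub>i\<close> are faithfully represented.  The result does not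
  depend on the representations.  That \<open>tens\<close> is multilinear, multiplicative, unital and
  *-preserving follows from the last condition, as \<open>\<rho>\<close> is injective.

  The type arguments are the types carrying the \<open>H\<^sub>i\<close> and their tensor product, since a definition
  cannot quantify over types.
\<close>

definition min_tensor_product ::
    "'h itself \<Rightarrow> 'k itself \<Rightarrow> 'i set \<Rightarrow> ('i \<Rightarrow> 'a cstar) \<Rightarrow> 'b cstar \<Rightarrow> (('i \<Rightarrow> 'a) \<Rightarrow> 'b) \<Rightarrow> bool"
  where "min_tensor_product TYPE('h) TYPE('k) I A T tens \<longleftrightarrow>
    unital_cstar_algebra T \<and>
    tens \<in> (\<Pi>\<^sub>E i\<in>I. carrier (A i)) \<rightarrow> carrier T \<and>
    closed_span T (cnorm T) (tens ` (\<Pi>\<^sub>E i\<in>I. carrier (A i))) = carrier T \<and>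
    (\<exists>(H :: 'i \<Rightarrow> 'h hilbert) \<pi> (K :: 'k hilbert) t \<rho>.
       (\<forall>i\<in>I. hilbert_space (H i) \<and> faithful_representation (A i) (H i) (\<pi> i)) \<and>
       hilbert_tensor_product I H K t \<and>
       star_representation T K \<rho> \<and>
       (\<forall>x\<in>carrier T. operator_norm K (\<rho> x) = cnorm T x) \<and>
       (\<forall>a\<in>\<Pi>\<^sub>E i\<in>I. carrier (A i). \<forall>\<xi>\<in>\<Pi>\<^sub>E i\<in>I. carrier (H i).
          \<rho> (tens a) (t \<xi>) = t (\<lambda>i\<in>I. \<pi> i (a i) (\<xi> i))))"

text \<open>
  The copy of the tensor product of the \<open>A\<^sub>j\<close>, \<open>j \<noteq> i\<close>, inside \<open>T\<close>; for \<open>I = {i}\<close> it consists of the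
  scalar multiples of the unit.
\<close>

definition tensor_omitting ::
    "'i set \<Rightarrow> ('i \<Rightarrow> 'a cstar) \<Rightarrow> 'b cstar \<Rightarrow> (('i \<Rightarrow> 'a) \<Rightarrow> 'b) \<Rightarrow> 'i \<Rightarrow> 'b set"
  where "tensor_omitting I A T tens i =
    closed_span T (cnorm T) {tens a |a. a \<in> (\<Pi>\<^sub>E j\<in>I. carrier (A j)) \<and> a i = \<one>\<^bsub>A i\<^esub>}"

subsection \<open>The quantum Hamming seminorm and dual norms\<close>

definition L_omit ::
    "'i set \<Rightarrow> ('i \<Rightarrow> 'a cstar) \<Rightarrow> 'b cstar \<Rightarrow> (('i \<Rightarrow> 'a) \<Rightarrow> 'b) \<Rightarrow> 'i \<Rightarrow> 'b \<Rightarrow> real"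
  where "L_omit I A T tens i a = 2 * (INF c\<in>tensor_omitting I A T tens i. cnorm T (a \<ominus>\<^bsub>T\<^esub> c))"

text \<open>Inserting 0 matters only for empty \<open>I\<close>, where the maximum would be unspecified.\<close>

definition L_qH ::
    "'i set \<Rightarrow> ('i \<Rightarrow> 'a cstar) \<Rightarrow> 'b cstar \<Rightarrow> (('i \<Rightarrow> 'a) \<Rightarrow> 'b) \<Rightarrow> 'b \<Rightarrow> real"
  where "L_qH I A T tens a = Max (insert 0 ((\<lambda>i. L_omit I A T tens i a) ` I))"

definition M0 :: "'b cstar \<Rightarrow> ('b \<Rightarrow> complex) set"
  where "M0 T = {\<phi>.
    (\<forall>a\<in>carrier T. \<forall>b\<in>carrier T. \<phi> (a \<oplus>\<^bsub>T\<^esub> b) = \<phi> a + \<phi> b) \<and>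
    (\<forall>c. \<forall>a\<in>carrier T. \<phi> (c \<odot>\<^bsub>T\<^esub> a) = c * \<phi> a) \<and>
    continuous_map (norm_topology T (cnorm T)) euclidean \<phi> \<and>
    (\<forall>c. \<phi> (c \<odot>\<^bsub>T\<^esub> \<one>\<^bsub>T\<^esub>) = 0)}"

definition annihilator_omitting ::
    "'i set \<Rightarrow> ('i \<Rightarrow> 'a cstar) \<Rightarrow> 'b cstar \<Rightarrow> (('i \<Rightarrow> 'a) \<Rightarrow> 'b) \<Rightarrow> 'i \<Rightarrow> ('b \<Rightarrow> complex) set"
  where "annihilator_omitting I A T tens i =
    {\<psi> \<in> M0 T. \<forall>c\<in>tensor_omitting I A T tens i. \<psi> c = 0}"

text \<open>The supremum is taken in \<open>[0, \<infinity>]\<close>, as its finiteness is not evident beforehand.\<close>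

definition dual_norm :: "'b cstar \<Rightarrow> ('b \<Rightarrow> real) \<Rightarrow> ('b \<Rightarrow> complex) \<Rightarrow> ennreal"
  where "dual_norm T L \<phi> = (SUP a\<in>{a \<in> carrier T. L a \<le> 1}. ennreal (cmod (\<phi> a)))"

end

theory Submission
  imports Defs
begin

text \<open>
  A decomposition of \<open>\<phi>\<close> into functionals \<open>\<phi>\<^sub>i\<close> bounds \<open>\<bar>\<phi> a\<bar>\<close> by \<open>\<Sum>\<parallel>\<phi>\<^sub>i\<parallel>\<^sub>i\<close> on the unit ball of \<open>L\<^sub>q\<^sub>H\<close>.
  Conversely, if \<open>\<parallel>\<phi>\<parallel>\<^sub>q\<^sub>H = C\<close> is finite, then \<open>\<phi>\<close>, read as a functional on the diagonal of the power of
  \<open>T\<close> indexed by \<open>I\<close>, is dominated by the seminorm \<open>C * max L\<^sub>i(x\<^sub>i)\<close>.  A Hahn-Banach extension to the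
  whole power splits into its restrictions \<open>\<phi>\<^sub>i\<close> to the factors.  They sum to \<open>\<phi>\<close>, they are dominated by
  \<open>C * L\<^sub>i\<close>, so they annihilate the subalgebras, and testing on unimodular multiples of the \<open>x\<^sub>i\<close> gives
  \<open>\<Sum>\<parallel>\<phi>\<^sub>i\<parallel>\<^sub>i \<le> C\<close>.  So the infimum is attained whenever it is finite.
\<close>

section \<open>The complex numbers as scalar ring\<close>

lemma complex_ring_simps [simp]:
  "carrier complex_ring = UNIV"
  "c \<oplus>\<^bsub>complex_ring\<^esub> d = c + d"
  "c \<otimes>\<^bsub>complex_ring\<^esub> d = c * d"
  "\<one>\<^bsub>complex_ring\<^esub> = 1"
  "\<zero>\<^bsub>complex_ring\<^esub> = 0"
  by (simp_all add: ring_of_type_algebra_def)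

subsection \<open>Sublinear functionals and the Hahn-Banach theorem\<close>

locale complex_module = module complex_ring M
  for M :: "(complex, 'a, 'm) module_scheme" (structure)
begin

lemma smult_add_left: "x \<in> carrier M \<Longrightarrow> (c + d) \<odot> x = c \<odot> x \<oplus> d \<odot> x"
  using smult_l_distr[of c d x] by simp

lemma smult_assoc: "x \<in> carrier M \<Longrightarrow> c \<odot> (d \<odot> x) = (c * d) \<odot> x"
  using smult_assoc1[of c d x] by simp

lemma smult_1: "x \<in> carrier M \<Longrightarrow> 1 \<odot> x = x"
  using smult_one[of x] by simp

lemma smult_0_left: "x \<in> carrier M \<Longrightarrow> 0 \<odot> x = \<zero>"
  using smult_l_null[of x] by simp

lemma smult_minus_1: "x \<in> carrier M \<Longrightarrow> (- 1) \<odot> x = \<ominus> x"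
proof -
  assume x: "x \<in> carrier M"
  have "(- 1) \<odot> x \<oplus> x = (- 1 + 1) \<odot> x"
    using x by (simp only: smult_add_left smult_1)
  then have "(- 1) \<odot> x \<oplus> x = \<zero>"
    using x by (simp add: smult_0_left)
  then show ?thesis
    using x by (simp add: M.minus_equality)
qed

definition sublinear :: "('a \<Rightarrow> real) \<Rightarrow> bool"
  where "sublinear p \<longleftrightarrow>
    (\<forall>x\<in>carrier M. \<forall>y\<in>carrier M. p (x \<oplus> y) \<le> p x + p y) \<and>
    (\<forall>r\<ge>0. \<forall>x\<in>carrier M. p (complex_of_real r \<odot> x) = r * p x)"

definition linear_functional :: "('a \<Rightarrow> complex) \<Rightarrow> bool"
  where "linear_functional f \<longleftrightarrow>
    (\<forall>x\<in>carrier M. \<forall>y\<in>carrier M. f (x \<oplus> y) = f x + f y) \<and>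
    (\<forall>c. \<forall>x\<in>carrier M. f (c \<odot> x) = c * f x)"

definition seminorm :: "('a \<Rightarrow> real) \<Rightarrow> bool"
  where "seminorm p \<longleftrightarrow>
    (\<forall>x\<in>carrier M. \<forall>y\<in>carrier M. p (x \<oplus> y) \<le> p x + p y) \<and>
    (\<forall>c. \<forall>x\<in>carrier M. p (c \<odot> x) = cmod c * p x)"

lemma seminorm_sublinear: "seminorm p \<Longrightarrow> sublinear p"
  by (simp add: seminorm_def sublinear_def)

text \<open>Nonnegativity is a consequence of the two defining properties:
  \<open>0 = p (x - x)\<close>, which is at most \<open>2 * p x\<close>.\<close>

lemma seminorm_nonneg:
  assumes "seminorm p" "x \<in> carrier M"
  shows "0 \<le> p x"
proof -
  have "(- 1) \<odot> x \<in> carrier M"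
    using assms(2) by simp
  then have "p (x \<oplus> (- 1) \<odot> x) \<le> p x + p ((- 1) \<odot> x)"
    using assms unfolding seminorm_def by blast
  moreover have "p ((- 1) \<odot> x) = p x" "p (0 \<odot> x) = 0"
    using assms unfolding seminorm_def by (metis (no_types) norm_minus_cancel norm_one mult_1, simp)
  moreover have "x \<oplus> (- 1) \<odot> x = 0 \<odot> x"
    using assms by (simp add: smult_minus_1 smult_0_left M.r_neg)
  ultimately show ?thesis by simp
qed

lemma sublinear_zero: "sublinear p \<Longrightarrow> p \<zero> = 0"
proof -
  assume "sublinear p"
  then have "p (complex_of_real 0 \<odot> \<zero>) = 0 * p \<zero>"
    unfolding sublinear_def by blast
  then show ?thesis by (simp add: smult_0_left)
qed

text \<open>Subadditivity for \<open>y = \<ominus> x \<oplus> (x \<oplus> y)\<close>. This lower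
  bound is what keeps the infima over chains and over cones finite.\<close>

lemma sublinear_lower:
  assumes "sublinear p" "x \<in> carrier M" "y \<in> carrier M"
  shows "p y - p (\<ominus> x) \<le> p (x \<oplus> y)"
proof -
  have "y = \<ominus> x \<oplus> (x \<oplus> y)"
    using assms by (simp add: M.r_neg1)
  then have "p y \<le> p (\<ominus> x) + p (x \<oplus> y)"
    using assms unfolding sublinear_def by (metis M.a_inv_closed M.add.m_closed)
  then show ?thesis by simp
qed

text \<open>Zorn's lemma for the reversed pointwise order: the pointwise infimum of a nonempty chain
  of sublinear functionals below \<open>p\<close> is again sublinear. Minimal elements will turn out
  to be real linear.\<close>

lemma sublinear_minimal:
  assumes p: "sublinear p"
  obtains m where "sublinear m" "\<And>x. x \<in> carrier M \<Longrightarrow> m x \<le> p x"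
    "\<And>q x. \<lbrakk>sublinear q; \<And>x. x \<in> carrier M \<Longrightarrow> q x \<le> m x; x \<in> carrier M\<rbrakk> \<Longrightarrow> q x = m x"
proof -
  \<comment> \<open>Off the carrier every member agrees with \<open>p\<close>, so that the order on
    total functions only compares values on the carrier.\<close>
  define S where "S = {q. sublinear q \<and> q \<le> p \<and> (\<forall>x. x \<notin> carrier M \<longrightarrow> q x = p x)}"
  have "\<exists>m\<in>S. \<forall>q\<in>S. m \<ge> q \<longrightarrow> q = m"
  proof (rule predicate_Zorn)
    show "partial_order_on S (relation_of (\<ge>) S)"
      by (auto simp: partial_order_on_def preorder_on_def refl_on_def trans_def antisym_def
          relation_of_def)
  next
    fix C assume C: "C \<in> Chains (relation_of (\<ge>) S)"
    then have CS: "C \<subseteq> S" and tot: "\<And>q r. \<lbrakk>q \<in> C; r \<in> C\<rbrakk> \<Longrightarrow> q \<le> r \<or> r \<le> q"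
      by (auto simp: Chains_def relation_of_def)
    show "\<exists>u\<in>S. \<forall>q\<in>C. q \<ge> u"
    proof (cases "C = {}")
      case True
      then show ?thesis using p by (auto simp: S_def)
    next
      case False
      define u where "u x = (INF q\<in>C. q x)" for x
      \<comment> \<open>A bound independent of \<open>q\<close>, coming from
        \<open>q (\<ominus> x) \<le> p (\<ominus> x)\<close>; it makes the infimum over the chain
        finite.\<close>
      have low: "- p (\<ominus> x) \<le> q x" if "q \<in> C" "x \<in> carrier M" for q x
      proof -
        have "q \<zero> - q (\<ominus> x) \<le> q (x \<oplus> \<zero>)" "q (\<ominus> x) \<le> p (\<ominus> x)" "q \<zero> = 0"
          using that CS sublinear_lower[of q x \<zero>] sublinear_zero[of q]
          by (auto simp: S_def le_fun_def)
        then show ?thesis using that by simp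
      qed
      have u_le: "u x \<le> q x" if "q \<in> C" for q x
        unfolding u_def
      proof (rule cINF_lower)
        show "bdd_below ((\<lambda>q. q x) ` C)"
        proof (cases "x \<in> carrier M")
          case True
          then show ?thesis using low by (intro bdd_belowI2) auto
        next
          case False
          then show ?thesis using CS by (intro bdd_belowI2[where m = "p x"]) (auto simp: S_def)
        qed
      qed (use that in auto)
      have u_ge: "c \<le> u x" if "\<And>q. q \<in> C \<Longrightarrow> c \<le> q x" for c x
        unfolding u_def using False that by (intro cINF_greatest)
      have "u x = p x" if "x \<notin> carrier M" for x
      proof -
        have "u x = (INF q\<in>C. p x)"
          unfolding u_def using that CS by (intro INF_cong) (auto simp: S_def)
        then show ?thesis using False by simp
      qed
      moreover have "u \<le> p"
      proof (rule le_funI)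
        fix x
        obtain q where "q \<in> C" using False by blast
        then show "u x \<le> p x"
          using u_le[of q x] CS by (auto simp: S_def le_fun_def intro: order_trans)
      qed
      moreover have "sublinear u"
        unfolding sublinear_def
      proof (intro conjI ballI allI impI)
        fix x y assume xy: "x \<in> carrier M" "y \<in> carrier M"
        \<comment> \<open>The chain contains a common lower bound of \<open>q\<close> and
          \<open>r\<close>, whose own subadditivity gives this mixed bound. The infima over
          \<open>r\<close> and over \<open>q\<close> can then be taken one after the other.\<close>
        have *: "u (x \<oplus> y) \<le> q x + r y" if qr: "q \<in> C" "r \<in> C" for q r
        proof -
          obtain s where s: "s \<in> C" "s \<le> q" "s \<le> r"
            using tot[OF qr] qr by blast
          then have "u (x \<oplus> y) \<le> s x + s y"
            using u_le[OF s(1), of "x \<oplus> y"] CS xy unfolding S_def sublinear_def by force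
          also have "\<dots> \<le> q x + r y"
            using s by (intro add_mono) (auto simp: le_fun_def)
          finally show ?thesis .
        qed
        have "u (x \<oplus> y) - u y \<le> u x"
        proof (rule u_ge)
          fix q assume q: "q \<in> C"
          have "u (x \<oplus> y) - q x \<le> u y"
            by (rule u_ge) (use *[OF q] in \<open>simp add: algebra_simps\<close>)
          then show "u (x \<oplus> y) - u y \<le> q x" by simp
        qed
        then show "u (x \<oplus> y) \<le> u x + u y" by simp
      next
        fix r :: real and x assume r: "0 \<le> r" and x: "x \<in> carrier M"
        have q: "q (complex_of_real r \<odot> x) = r * q x" if "q \<in> C" for q
          using that CS r x by (auto simp: S_def sublinear_def)
        show "u (complex_of_real r \<odot> x) = r * u x"
        proof (rule antisym)
          show "r * u x \<le> u (complex_of_real r \<odot> x)"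
            by (rule u_ge) (simp add: q mult_left_mono r u_le)
          show "u (complex_of_real r \<odot> x) \<le> r * u x"
          proof (cases "r = 0")
            case True
            obtain q0 where "q0 \<in> C" using False by blast
            then show ?thesis
              using u_le[of q0 "complex_of_real r \<odot> x"] q[of q0] True by simp
          next
            case r0: False
            have "u (complex_of_real r \<odot> x) / r \<le> u x"
            proof (rule u_ge)
              fix q' assume "q' \<in> C"
              then show "u (complex_of_real r \<odot> x) / r \<le> q' x"
                using u_le[of q' "complex_of_real r \<odot> x"] q r r0 by (simp add: field_simps)
            qed
            then show ?thesis using r r0 by (simp add: field_simps)
          qed
        qed
      qed
      ultimately show ?thesis using u_le by (auto simp: S_def le_fun_def)
    qed
  qed
  then obtain m where m: "m \<in> S" "\<And>q. \<lbrakk>q \<in> S; q \<le> m\<rbrakk> \<Longrightarrow> q = m" by blast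
  show ?thesis
  proof (rule that)
    show "sublinear m" "m x \<le> p x" for x
      using m by (auto simp: S_def le_fun_def)
    fix q x assume q: "sublinear q" "\<And>x. x \<in> carrier M \<Longrightarrow> q x \<le> m x" and x: "x \<in> carrier M"
    \<comment> \<open>Membership in \<open>S\<close> requires the values of \<open>p\<close> off the
      carrier.\<close>
    define q' where "q' x = (if x \<in> carrier M then q x else p x)" for x
    have le: "q' \<le> m"
      using q m(1) by (auto simp: q'_def le_fun_def S_def)
    have "sublinear q'"
      using q(1) by (auto simp: sublinear_def q'_def)
    with le m(1) have "q' \<in> S"
      by (auto simp: S_def q'_def)
    with le m(2) have "q' = m" by blast
    then have "m x = q' x" by simp
    then show "q x = m x" using x by (simp add: q'_def)
  qed
qed

text \<open>
  Both the linearity of minimal sublinear functionals and the extension step of the Hahn-Banach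
  theorem follow from this one infimum, with \<open>W\<close> a ray and a subspace respectively.
\<close>

lemma sublinear_inf_cone:
  assumes p: "sublinear p"
    and W: "W \<subseteq> carrier M" "\<zero> \<in> W" "\<And>v w. \<lbrakk>v \<in> W; w \<in> W\<rbrakk> \<Longrightarrow> v \<oplus> w \<in> W"
      "\<And>r w. \<lbrakk>0 \<le> r; w \<in> W\<rbrakk> \<Longrightarrow> complex_of_real r \<odot> w \<in> W"
    and f_add: "\<And>v w. \<lbrakk>v \<in> W; w \<in> W\<rbrakk> \<Longrightarrow> f v + f w \<le> f (v \<oplus> w)"
    and f_smult: "\<And>r w. \<lbrakk>0 \<le> r; w \<in> W\<rbrakk> \<Longrightarrow> f (complex_of_real r \<odot> w) = r * f w"
    and f_le: "\<And>w. w \<in> W \<Longrightarrow> f w \<le> p w"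
  obtains q where "sublinear q" "\<And>x w. \<lbrakk>x \<in> carrier M; w \<in> W\<rbrakk> \<Longrightarrow> q x \<le> p (x \<oplus> w) - f w"
proof -
  \<comment> \<open>The choice \<open>x = \<ominus> w\<close> gives
    \<open>q (\<ominus> w) \<le> - f w\<close>, so a real linear functional below \<open>q\<close>
    is at least \<open>f\<close> on \<open>W\<close>; the choice \<open>w = \<zero>\<close> gives
    \<open>q x \<le> p x\<close>.\<close>
  define q where "q x = (INF w\<in>W. p (x \<oplus> w) - f w)" for x
  have low: "- p (\<ominus> x) \<le> p (x \<oplus> w) - f w" if "x \<in> carrier M" "w \<in> W" for x w
    using sublinear_lower[OF p, of x w] f_le[of w] that W(1) by fastforce
  have q_le: "q x \<le> p (x \<oplus> w) - f w" if "x \<in> carrier M" "w \<in> W" for x w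
    unfolding q_def using low that by (intro cINF_lower bdd_belowI2) auto
  have q_ge: "c \<le> q x" if "\<And>w. w \<in> W \<Longrightarrow> c \<le> p (x \<oplus> w) - f w" for c x
    unfolding q_def using W(2) that by (intro cINF_greatest) auto
  have "sublinear q"
    unfolding sublinear_def
  proof (intro conjI ballI allI impI)
    fix x y assume xy: "x \<in> carrier M" "y \<in> carrier M"
    \<comment> \<open>The pair \<open>v\<close>, \<open>w\<close> is tested through the single
      element \<open>v \<oplus> w\<close>; superadditivity of \<open>f\<close> has the right
      direction because \<open>f\<close> enters with a minus sign.\<close>
    have *: "q (x \<oplus> y) \<le> (p (x \<oplus> v) - f v) + (p (y \<oplus> w) - f w)" if vw: "v \<in> W" "w \<in> W" for v w
    proof -
      have c: "v \<in> carrier M" "w \<in> carrier M" using vw W(1) by auto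
      have "q (x \<oplus> y) \<le> p (x \<oplus> y \<oplus> (v \<oplus> w)) - f (v \<oplus> w)"
        using xy vw W(3) by (intro q_le) auto
      also have "x \<oplus> y \<oplus> (v \<oplus> w) = (x \<oplus> v) \<oplus> (y \<oplus> w)"
        using xy c by (simp add: M.a_ac)
      also have "p \<dots> \<le> p (x \<oplus> v) + p (y \<oplus> w)"
        using p xy c unfolding sublinear_def by blast
      finally show ?thesis using f_add[OF vw] by simp
    qed
    have "q (x \<oplus> y) - q y \<le> q x"
    proof (rule q_ge)
      fix v assume v: "v \<in> W"
      have "q (x \<oplus> y) - (p (x \<oplus> v) - f v) \<le> q y"
      proof (rule q_ge)
        fix w assume "w \<in> W"
        from *[OF v this] show "q (x \<oplus> y) - (p (x \<oplus> v) - f v) \<le> p (y \<oplus> w) - f w" by simp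
      qed
      then show "q (x \<oplus> y) - q y \<le> p (x \<oplus> v) - f v" by simp
    qed
    then show "q (x \<oplus> y) \<le> q x + q y" by simp
  next
    fix r :: real and x assume r: "0 \<le> r" and x: "x \<in> carrier M"
    have q_scale: "q (complex_of_real r \<odot> x) \<le> r * q x"
      if r: "0 < r" and x: "x \<in> carrier M" for r x
    proof -
      have "q (complex_of_real r \<odot> x) / r \<le> q x"
      proof (rule q_ge)
        fix w assume w: "w \<in> W"
        have "q (complex_of_real r \<odot> x)
            \<le> p (complex_of_real r \<odot> x \<oplus> complex_of_real r \<odot> w) - f (complex_of_real r \<odot> w)"
          using x w r W(4) by (intro q_le) auto
        also have "complex_of_real r \<odot> x \<oplus> complex_of_real r \<odot> w = complex_of_real r \<odot> (x \<oplus> w)"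
          using x w W(1) by (subst smult_r_distr) auto
        also have "p \<dots> = r * p (x \<oplus> w)"
          using p r x w W(1) unfolding sublinear_def by (meson M.a_closed less_imp_le subsetD)
        also have "f (complex_of_real r \<odot> w) = r * f w"
          using f_smult w r by simp
        also have "r * p (x \<oplus> w) - r * f w = (p (x \<oplus> w) - f w) * r"
          by (simp add: algebra_simps)
        finally show "q (complex_of_real r \<odot> x) / r \<le> p (x \<oplus> w) - f w"
          by (simp only: pos_divide_le_eq[OF r])
      qed
      then show ?thesis
        by (simp only: pos_divide_le_eq[OF r] mult.commute)
    qed
    show "q (complex_of_real r \<odot> x) = r * q x"
    proof (cases "r = 0")
      case True
      have f0: "f \<zero> = 0"
        using f_smult[of 0 \<zero>] W(2) by (simp add: smult_0_left)
      have "q \<zero> = 0"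
      proof (rule antisym)
        show "q \<zero> \<le> 0"
          using q_le[of \<zero> \<zero>] W(2) f0 sublinear_zero[OF p] by simp
        show "0 \<le> q \<zero>"
          using f_le W(1) by (intro q_ge) (simp add: subsetD)
      qed
      then show ?thesis using True x by (simp add: smult_0_left)
    next
      case False
      then have r: "0 < r" using r by simp
      \<comment> \<open>The reverse inequality is \<open>q_scale\<close> for the factor
        \<open>1 / r\<close> at the point \<open>r x\<close>.\<close>
      have "q (complex_of_real (1 / r) \<odot> (complex_of_real r \<odot> x))
          \<le> 1 / r * q (complex_of_real r \<odot> x)"
        using r x by (intro q_scale) auto
      also have "complex_of_real (1 / r) \<odot> (complex_of_real r \<odot> x) = x"
        using r x by (simp add: smult_assoc smult_1)
      finally have "r * q x \<le> q (complex_of_real r \<odot> x)"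
        using r by (simp add: field_simps)
      with q_scale[OF r x] show ?thesis by simp
    qed
  qed
  with q_le show ?thesis by (intro that)
qed

text \<open>A minimal sublinear functional \<open>L\<close> is real linear. Lowering
  \<open>L\<close> along the ray through \<open>y\<close> gives a sublinear functional below
  \<open>L\<close>, hence \<open>L\<close> itself by minimality, and this says that \<open>L\<close>
  is superadditive.\<close>

lemma sublinear_dominates_real_linear:
  assumes p: "sublinear p"
  obtains L where "\<And>x. x \<in> carrier M \<Longrightarrow> L x \<le> p x"
    "\<And>x y. \<lbrakk>x \<in> carrier M; y \<in> carrier M\<rbrakk> \<Longrightarrow> L (x \<oplus> y) = L x + L y"
    "\<And>r x. x \<in> carrier M \<Longrightarrow> L (complex_of_real r \<odot> x) = r * L x"
proof -
  obtain L where L: "sublinear L" "\<And>x. x \<in> carrier M \<Longrightarrow> L x \<le> p x"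
    and minimal: "\<And>q x. \<lbrakk>sublinear q; \<And>x. x \<in> carrier M \<Longrightarrow> q x \<le> L x; x \<in> carrier M\<rbrakk> \<Longrightarrow> q x = L x"
    using sublinear_minimal[OF p] by blast
  have add: "L (x \<oplus> y) = L x + L y" if x: "x \<in> carrier M" and y: "y \<in> carrier M" for x y
  proof (rule antisym)
    show "L (x \<oplus> y) \<le> L x + L y" using L(1) x y by (simp add: sublinear_def)
    \<comment> \<open>On this ray \<open>L\<close> is additive by homogeneity, so \<open>L\<close>
      can serve both as the majorant and as the functional on the cone.\<close>
    define W where "W = (\<lambda>t. complex_of_real t \<odot> y) ` {0..}"
    have ray: "L (complex_of_real t \<odot> y) = t * L y" if "0 \<le> t" for t
      using that L(1) y by (simp add: sublinear_def)
    have W_add: "complex_of_real s \<odot> y \<oplus> complex_of_real t \<odot> y = complex_of_real (s + t) \<odot> y"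
      for s t using y by (simp add: smult_add_left)
    obtain q where q: "sublinear q"
      "\<And>x w. \<lbrakk>x \<in> carrier M; w \<in> W\<rbrakk> \<Longrightarrow> q x \<le> L (x \<oplus> w) - L w"
    proof (rule sublinear_inf_cone[OF L(1), of W L])
      show "W \<subseteq> carrier M" using y by (auto simp: W_def)
      have "complex_of_real 0 \<odot> y \<in> W" unfolding W_def by blast
      then show "\<zero> \<in> W" using y by (simp add: smult_0_left)
      fix v w assume "v \<in> W" "w \<in> W"
      then obtain s t where st: "0 \<le> s" "0 \<le> t"
        "v = complex_of_real s \<odot> y" "w = complex_of_real t \<odot> y"
        by (auto simp: W_def)
      then show "v \<oplus> w \<in> W"
        unfolding st W_add by (auto simp: W_def simp del: of_real_add)
      show "L v + L w \<le> L (v \<oplus> w)"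
        unfolding st W_add using st(1,2) by (simp add: ray algebra_simps del: of_real_add)
    next
      fix r :: real and w assume r: "0 \<le> r" and w: "w \<in> W"
      then obtain t where t: "0 \<le> t" "w = complex_of_real t \<odot> y" by (auto simp: W_def)
      have "complex_of_real r \<odot> w = complex_of_real (r * t) \<odot> y"
        using t y by (simp add: smult_assoc)
      then show "complex_of_real r \<odot> w \<in> W"
        using r t unfolding W_def by (metis atLeast_iff image_eqI mult_nonneg_nonneg)
      show "L (complex_of_real r \<odot> w) = r * L w"
        using L(1) r t y by (simp add: sublinear_def)
    qed auto
    have W: "complex_of_real 0 \<odot> y \<in> W" "complex_of_real 1 \<odot> y \<in> W"
      unfolding W_def by (intro imageI; simp)+
    \<comment> \<open>The parameter 0 of the ray gives \<open>q \<le> L\<close>, hence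
      \<open>q = L\<close> by minimality; the parameter 1 then gives the missing inequality.\<close>
    have "q z \<le> L z" if "z \<in> carrier M" for z
      using q(2)[OF that W(1)] y that sublinear_zero[OF L(1)] by (simp add: smult_0_left)
    then have "q x = L x" using minimal q(1) x by blast
    moreover have "q x \<le> L (x \<oplus> y) - L y"
      using q(2)[OF x W(2)] y by (simp add: smult_1)
    ultimately show "L x + L y \<le> L (x \<oplus> y)" by simp
  qed
  have neg: "L (\<ominus> x) = - L x" if "x \<in> carrier M" for x
    using add[of x "\<ominus> x"] that sublinear_zero[OF L(1)] by (simp add: M.r_neg)
  have "L (complex_of_real r \<odot> x) = r * L x" if x: "x \<in> carrier M" for r x
  proof (cases "0 \<le> r")
    case True
    then show ?thesis using L(1) x by (simp add: sublinear_def)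
  next
    case False
    then have "0 \<le> - r" by simp
    then have "L (complex_of_real (- r) \<odot> x) = - r * L x"
      using L(1) x unfolding sublinear_def by blast
    moreover have "complex_of_real r \<odot> x = \<ominus> (complex_of_real (- r) \<odot> x)"
      using x by (simp add: smult_minus_1[symmetric] smult_assoc)
    ultimately show ?thesis using neg[of "complex_of_real (- r) \<odot> x"] x by simp
  qed
  with L(2) add show ?thesis by (intro that)
qed

text \<open>The infimum over the subspace \<open>W\<close> yields \<open>q\<close> below
  \<open>p\<close> such that every real linear functional below \<open>q\<close> agrees with
  \<open>Re f\<close> on \<open>W\<close>. Such a functional is complexified, and the bound on the
  modulus follows because \<open>p\<close> is invariant under unimodular scalars.\<close>

theorem hahn_banach_seminorm:
  assumes p: "seminorm p" and W: "submodule W complex_ring M"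
    and f_add: "\<And>v w. \<lbrakk>v \<in> W; w \<in> W\<rbrakk> \<Longrightarrow> f (v \<oplus> w) = f v + f w"
    and f_smult: "\<And>c w. w \<in> W \<Longrightarrow> f (c \<odot> w) = c * f w"
    and f_le: "\<And>w. w \<in> W \<Longrightarrow> cmod (f w) \<le> p w"
  obtains F where "linear_functional F" "\<And>w. w \<in> W \<Longrightarrow> F w = f w"
    "\<And>x. x \<in> carrier M \<Longrightarrow> cmod (F x) \<le> p x"
proof -
  have sub: "W \<subseteq> carrier M" and W_add: "\<And>v w. \<lbrakk>v \<in> W; w \<in> W\<rbrakk> \<Longrightarrow> v \<oplus> w \<in> W"
    and W_smult: "\<And>c w. w \<in> W \<Longrightarrow> c \<odot> w \<in> W" and W_ne: "W \<noteq> {}"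
    using submoduleE[OF W] by auto
  have W_0: "\<zero> \<in> W"
    using W_ne W_smult[of _ 0] sub by (metis all_not_in_conv smult_0_left subsetD)
  obtain q where q: "sublinear q"
    "\<And>x w. \<lbrakk>x \<in> carrier M; w \<in> W\<rbrakk> \<Longrightarrow> q x \<le> p (x \<oplus> w) - Re (f w)"
  proof (rule sublinear_inf_cone[OF seminorm_sublinear[OF p], of W "\<lambda>w. Re (f w)"])
    show "Re (f w) \<le> p w" if "w \<in> W" for w
      using f_le[OF that] complex_Re_le_cmod order_trans by blast
  qed (auto simp: sub W_0 W_add W_smult f_add f_smult)
  obtain L where L_le: "\<And>x. x \<in> carrier M \<Longrightarrow> L x \<le> q x"
    and L_add: "\<And>x y. \<lbrakk>x \<in> carrier M; y \<in> carrier M\<rbrakk> \<Longrightarrow> L (x \<oplus> y) = L x + L y"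
    and L_smult: "\<And>r x. x \<in> carrier M \<Longrightarrow> L (complex_of_real r \<odot> x) = r * L x"
    using sublinear_dominates_real_linear[OF q(1)] by blast
  have L_le_p: "L x \<le> p x" if "x \<in> carrier M" for x
    using L_le[OF that] q(2)[OF that W_0] that f_smult[OF W_0, of 0] by (simp add: smult_0_left)
  have L_neg: "L ((- c) \<odot> x) = - L (c \<odot> x)" if "x \<in> carrier M" for c x
    using L_smult[of "c \<odot> x" "- 1"] that by (simp add: smult_assoc)
  have L_W: "L w = Re (f w)" if w: "w \<in> W" for w
  proof -
    \<comment> \<open>The infimum defining \<open>q\<close> is tested with \<open>v\<close> at the
      point \<open>- v\<close>, where the sum is zero. Using this for \<open>w\<close> and for
      \<open>- w\<close> gives both inequalities.\<close>
    have *: "L ((- 1) \<odot> v) \<le> - Re (f v)" if v: "v \<in> W" for v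
    proof -
      have c: "v \<in> carrier M" using v sub by blast
      have "L ((- 1) \<odot> v) \<le> p ((- 1) \<odot> v \<oplus> v) - Re (f v)"
        using L_le[of "(- 1) \<odot> v"] q(2)[of "(- 1) \<odot> v" v] c v by simp
      also have "(- 1) \<odot> v \<oplus> v = \<zero>"
        using c by (simp add: smult_minus_1 M.l_neg)
      finally show ?thesis
        using sublinear_zero[OF seminorm_sublinear[OF p]] by simp
    qed
    have c: "w \<in> carrier M" using w sub by blast
    have "Re (f w) \<le> L w"
      using *[OF w] L_neg[OF c, of 1] c by (simp add: smult_1)
    moreover have "L w \<le> Re (f w)"
      using *[OF W_smult[OF w, of "- 1"]] c f_smult[OF w, of "- 1"]
      by (simp add: smult_assoc smult_1)
    ultimately show ?thesis by simp
  qed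
  \<comment> \<open>A complex linear functional is determined by its real part, since
    \<open>Im (F x) = - Re (F (\<i> \<odot> x))\<close>.\<close>
  define F where "F x = Complex (L x) (- L (\<i> \<odot> x))" for x
  have F_add: "F (x \<oplus> y) = F x + F y" if "x \<in> carrier M" "y \<in> carrier M" for x y
    using that smult_r_distr[of \<i> x y] by (simp add: F_def L_add complex_eq_iff)
  have F_smult: "F (c \<odot> x) = c * F x" if x: "x \<in> carrier M" for c x
  proof -
    have *: "L (c \<odot> x) = Re c * L x + Im c * L (\<i> \<odot> x)" for c
    proof -
      have "c \<odot> x = (complex_of_real (Re c) + complex_of_real (Im c) * \<i>) \<odot> x"
        by (metis complex_eq mult.commute)
      also have "\<dots> = complex_of_real (Re c) \<odot> x \<oplus> complex_of_real (Im c) \<odot> (\<i> \<odot> x)"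
        using x by (simp add: smult_add_left smult_assoc)
      finally show ?thesis
        using x by (simp add: L_add L_smult)
    qed
    have "L (\<i> \<odot> (c \<odot> x)) = - Im c * L x + Re c * L (\<i> \<odot> x)"
      using *[of "\<i> * c"] x by (simp add: smult_assoc)
    with *[of c] show ?thesis
      by (simp add: F_def complex_eq_iff)
  qed
  have F_le: "cmod (F x) \<le> p x" if x: "x \<in> carrier M" for x
  proof (cases "F x = 0")
    case True
    then show ?thesis using seminorm_nonneg[OF p x] by simp
  next
    case False
    \<comment> \<open>The phase \<open>c\<close> rotates \<open>F x\<close> onto the positive real
      axis, where \<open>F\<close> coincides with \<open>L\<close>.\<close>
    define c where "c = cnj (F x) / complex_of_real (cmod (F x))"
    have c: "cmod c = 1" "c * F x = complex_of_real (cmod (F x))"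
      using False
      by (simp_all add: c_def norm_divide complex_norm_square[symmetric] power2_eq_square mult.commute)
    have "complex_of_real (cmod (F x)) = F (c \<odot> x)"
      using x by (simp add: F_smult c)
    then have "cmod (F x) = L (c \<odot> x)"
      by (simp add: F_def complex_eq_iff)
    also have "\<dots> \<le> p (c \<odot> x)" using x by (intro L_le_p) simp
    also have "\<dots> = p x" using p x c(1) by (simp add: seminorm_def)
    finally show ?thesis .
  qed
  show ?thesis
  proof (rule that[OF _ _ F_le])
    show "linear_functional F" using F_add F_smult by (simp add: linear_functional_def)
    show "F w = f w" if "w \<in> W" for w
      using that sub W_smult[OF that, of \<i>] f_smult[OF that, of \<i>]
      by (simp add: F_def L_W complex_eq_iff)
  qed
qed

end

text \<open>Scaling \<open>x\<close> into the unit ball of \<open>p\<close> suffices unless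
  \<open>p x = 0\<close>. In that case all multiples of \<open>x\<close> lie in the unit ball, and
  boundedness there forces \<open>f x = 0\<close>.\<close>

lemma (in complex_module) linear_functional_le_seminorm:
  assumes p: "seminorm p" and f: "linear_functional f" and C: "0 \<le> C"
    and f_le: "\<And>x. \<lbrakk>x \<in> carrier M; p x \<le> 1\<rbrakk> \<Longrightarrow> cmod (f x) \<le> C" and x: "x \<in> carrier M"
  shows "cmod (f x) \<le> C * p x"
proof -
  have scaled: "r * cmod (f x) \<le> C" if r: "0 \<le> r" "r * p x \<le> 1" for r
    using f_le[of "complex_of_real r \<odot> x"] p f x r
    by (simp add: seminorm_def linear_functional_def norm_mult)
  show ?thesis
  proof (cases "p x = 0")
    case True
    have "cmod (f x) = 0"
    proof (rule ccontr)
      assume "cmod (f x) \<noteq> 0"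
      then show False
        \<comment> \<open>With this factor the bound would read
          \<open>C + 1 \<le> C\<close>.\<close>
        using scaled[of "(C + 1) / cmod (f x)"] True C by simp
    qed
    then show ?thesis using True by simp
  next
    case False
    then have "0 < p x" using seminorm_nonneg[OF p x] by simp
    then show ?thesis using scaled[of "1 / p x"] by (simp add: pos_divide_le_eq)
  qed
qed

subsection \<open>Decomposition of functionals dominated by a maximum of seminorms\<close>

text \<open>The direct power of \<open>M\<close>. Tuples are extensional functions, so that the
  module laws hold as equalities of functions.\<close>

definition power_module :: "'i set \<Rightarrow> ('r, 'a, 'm) module_scheme \<Rightarrow> ('r, 'i \<Rightarrow> 'a) module"
  where "power_module I M =
    \<lparr>carrier = (\<Pi>\<^sub>E i\<in>I. carrier M), monoid.mult = (\<lambda>x y. \<lambda>i\<in>I. x i \<otimes>\<^bsub>M\<^esub> y i), monoid.one = (\<lambda>i\<in>I. \<one>\<^bsub>M\<^esub>),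
     ring.zero = (\<lambda>i\<in>I. \<zero>\<^bsub>M\<^esub>), ring.add = (\<lambda>x y. \<lambda>i\<in>I. x i \<oplus>\<^bsub>M\<^esub> y i),
     module.smult = (\<lambda>c x. \<lambda>i\<in>I. c \<odot>\<^bsub>M\<^esub> x i)\<rparr>"

lemma power_module_simps [simp]:
  "carrier (power_module I M) = (\<Pi>\<^sub>E i\<in>I. carrier M)"
  "x \<oplus>\<^bsub>power_module I M\<^esub> y = (\<lambda>i\<in>I. x i \<oplus>\<^bsub>M\<^esub> y i)"
  "\<zero>\<^bsub>power_module I M\<^esub> = (\<lambda>i\<in>I. \<zero>\<^bsub>M\<^esub>)"
  "c \<odot>\<^bsub>power_module I M\<^esub> x = (\<lambda>i\<in>I. c \<odot>\<^bsub>M\<^esub> x i)"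
  by (simp_all add: power_module_def)

lemma (in module) module_power_module: "module R (power_module I M)"
proof (rule moduleI)
  show "cring R" by (rule R.is_cring)
  show "abelian_group (power_module I M)"
  proof (rule abelian_groupI)
    fix x assume x: "x \<in> carrier (power_module I M)"
    then have "(\<lambda>i\<in>I. \<ominus>\<^bsub>M\<^esub> x i) \<in> carrier (power_module I M)"
      by auto
    moreover have "(\<lambda>i\<in>I. \<ominus>\<^bsub>M\<^esub> x i) \<oplus>\<^bsub>power_module I M\<^esub> x = \<zero>\<^bsub>power_module I M\<^esub>"
      using x by (auto simp: fun_eq_iff restrict_def PiE_iff M.l_neg)
    ultimately show "\<exists>y\<in>carrier (power_module I M).
        y \<oplus>\<^bsub>power_module I M\<^esub> x = \<zero>\<^bsub>power_module I M\<^esub>" by blast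
  qed (auto simp: fun_eq_iff PiE_iff extensional_def M.a_ac)
qed (auto simp: fun_eq_iff PiE_iff extensional_def smult_l_distr smult_r_distr smult_assoc1)

context complex_module
begin

lemma complex_module_power_module: "complex_module (power_module I M)"
  by (simp add: complex_module_def module_power_module)

lemma seminorm_Max:
  assumes I: "finite I" "I \<noteq> {}" and L: "\<And>i. i \<in> I \<Longrightarrow> seminorm (L i)" and C: "0 \<le> C"
  shows "complex_module.seminorm (power_module I M) (\<lambda>x. C * (MAX i\<in>I. L i (x i)))"
  unfolding complex_module.seminorm_def[OF complex_module_power_module]
proof (intro conjI ballI allI)
  fix x y assume "x \<in> carrier (power_module I M)" "y \<in> carrier (power_module I M)"
  then have xy: "x i \<in> carrier M" "y i \<in> carrier M" if "i \<in> I" for i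
    using that by auto
  have "L i (x i \<oplus> y i) \<le> (MAX i\<in>I. L i (x i)) + (MAX i\<in>I. L i (y i))" if i: "i \<in> I" for i
  proof -
    have "L i (x i \<oplus> y i) \<le> L i (x i) + L i (y i)"
      using L xy i by (simp add: seminorm_def)
    also have "\<dots> \<le> (MAX i\<in>I. L i (x i)) + (MAX i\<in>I. L i (y i))"
      using I i by (intro add_mono Max_ge) auto
    finally show ?thesis .
  qed
  then have "(MAX i\<in>I. L i (x i \<oplus> y i)) \<le> (MAX i\<in>I. L i (x i)) + (MAX i\<in>I. L i (y i))"
    using I by (intro Max.boundedI) auto
  then show "C * (MAX i\<in>I. L i ((x \<oplus>\<^bsub>power_module I M\<^esub> y) i))
      \<le> C * (MAX i\<in>I. L i (x i)) + C * (MAX i\<in>I. L i (y i))"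
    using C by (simp add: mult_left_mono flip: distrib_left cong: image_cong)
next
  fix c x assume "x \<in> carrier (power_module I M)"
  then have x: "x i \<in> carrier M" if "i \<in> I" for i
    using that by auto
  have "(MAX i\<in>I. L i (c \<odot> x i)) = Max ((\<lambda>r. cmod c * r) ` (\<lambda>i. L i (x i)) ` I)"
    unfolding image_image using x L by (simp add: seminorm_def cong: image_cong)
  also have "\<dots> = cmod c * (MAX i\<in>I. L i (x i))"
    using I by (intro mono_Max_commute[symmetric]) (auto intro!: monoI mult_left_mono)
  finally show "C * (MAX i\<in>I. L i ((c \<odot>\<^bsub>power_module I M\<^esub> x) i)) = cmod c * (C * (MAX i\<in>I. L i (x i)))"
    by (simp cong: image_cong)
qed

text \<open>A tuple is the sum of its one-coordinate parts. The induction runs over the set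
  \<open>J\<close> of coordinates that have not been replaced by zero.\<close>

lemma linear_functional_power_module:
  fixes I :: "'i set"
  assumes I: "finite I" and F: "complex_module.linear_functional (power_module I M) F"
    and x: "x \<in> (\<Pi>\<^sub>E i\<in>I. carrier M)"
  shows "F x = (\<Sum>i\<in>I. F (\<lambda>j\<in>I. if j = i then x i else \<zero>))"
proof -
  interpret P: complex_module "power_module I M"
    by (rule complex_module_power_module)
  have *: "F (\<lambda>j\<in>I. if j \<in> J then x j else \<zero>) = (\<Sum>i\<in>J. F (\<lambda>j\<in>I. if j = i then x i else \<zero>))"
    if "finite J" "J \<subseteq> I" for J
    using that
  proof (induction J rule: finite_induct)
    case empty
    have "F (0 \<odot>\<^bsub>power_module I M\<^esub> x) = 0"
      using F x unfolding P.linear_functional_def by (metis mult_zero_left power_module_simps(1))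
    moreover have "(\<lambda>j\<in>I. if j \<in> {} then x j else \<zero>) = 0 \<odot>\<^bsub>power_module I M\<^esub> x"
      using x by (auto simp: fun_eq_iff PiE_iff smult_0_left)
    ultimately show ?case by (simp only: sum.empty)
  next
    case (insert i J)
    let ?u = "\<lambda>j\<in>I. if j = i then x i else \<zero>" and ?v = "\<lambda>j\<in>I. if j \<in> J then x j else \<zero>"
    have "?u \<in> carrier (power_module I M)" "?v \<in> carrier (power_module I M)"
      using x insert.prems by (auto simp: PiE_iff)
    then have "F (?u \<oplus>\<^bsub>power_module I M\<^esub> ?v) = F ?u + F ?v"
      using F unfolding P.linear_functional_def by blast
    moreover have "?u \<oplus>\<^bsub>power_module I M\<^esub> ?v = (\<lambda>j\<in>I. if j \<in> insert i J then x j else \<zero>)"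
      using x insert.hyps insert.prems by (auto simp: fun_eq_iff PiE_iff)
    moreover have "F ?v = (\<Sum>i\<in>J. F (\<lambda>j\<in>I. if j = i then x i else \<zero>))"
      using insert.IH insert.prems by blast
    ultimately show ?case
      by (simp only: sum.insert[OF insert.hyps])
  qed
  have "(\<lambda>j\<in>I. if j \<in> I then x j else \<zero>) = x"
    using x by (auto simp: fun_eq_iff PiE_iff extensional_def)
  then show ?thesis using *[OF I] by simp
qed

text \<open>The last bound concerns arbitrary tuples and not only constant ones: this controls the
  sum of the dual norms of the \<open>\<psi> i\<close>, whose test elements vary
  independently.\<close>

theorem linear_functional_decomposition:
  fixes I :: "'i set"
  assumes I: "finite I" "I \<noteq> {}" and L: "\<And>i. i \<in> I \<Longrightarrow> seminorm (L i)"
    and \<phi>: "linear_functional \<phi>" and C: "0 \<le> C"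
    and \<phi>_le: "\<And>a. a \<in> carrier M \<Longrightarrow> cmod (\<phi> a) \<le> C * (MAX i\<in>I. L i a)"
  obtains \<psi> where "\<And>i. i \<in> I \<Longrightarrow> linear_functional (\<psi> i)"
    "\<And>a. a \<in> carrier M \<Longrightarrow> \<phi> a = (\<Sum>i\<in>I. \<psi> i a)"
    "\<And>x. x \<in> I \<rightarrow> carrier M \<Longrightarrow> (\<Sum>i\<in>I. cmod (\<psi> i (x i))) \<le> C * (MAX i\<in>I. L i (x i))"
proof -
  interpret P: complex_module "power_module I M"
    by (rule complex_module_power_module)
  \<comment> \<open>An arbitrary index, used to read off the common entry of a constant
    tuple.\<close>
  obtain k where k: "k \<in> I" using I by blast
  define W where "W = (\<lambda>a. \<lambda>i\<in>I. a) ` carrier M"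
  define p where "p x = C * (MAX i\<in>I. L i (x i))" for x
  have W: "submodule W complex_ring (power_module I M)"
  proof (rule P.submoduleI)
    show "W \<subseteq> carrier (power_module I M)" by (auto simp: W_def)
    show "\<zero>\<^bsub>power_module I M\<^esub> \<in> W" by (auto simp: W_def)
    show smult: "c \<odot>\<^bsub>power_module I M\<^esub> w \<in> W" if w: "w \<in> W" for c w
    proof -
      obtain a where "a \<in> carrier M" "w = (\<lambda>i\<in>I. a)" using w by (auto simp: W_def)
      then have "c \<odot> a \<in> carrier M" "c \<odot>\<^bsub>power_module I M\<^esub> w = (\<lambda>i\<in>I. c \<odot> a)"
        by (auto simp: fun_eq_iff)
      then show ?thesis unfolding W_def by blast
    qed
    show "\<ominus>\<^bsub>power_module I M\<^esub> w \<in> W" if "w \<in> W" for w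
      using smult[OF that, of "- 1"] P.smult_minus_1[of w] \<open>W \<subseteq> carrier (power_module I M)\<close> that
      by (metis subsetD)
    show "v \<oplus>\<^bsub>power_module I M\<^esub> w \<in> W" if "v \<in> W" "w \<in> W" for v w
    proof -
      obtain a b where "a \<in> carrier M" "v = (\<lambda>i\<in>I. a)" "b \<in> carrier M" "w = (\<lambda>i\<in>I. b)"
        using \<open>v \<in> W\<close> \<open>w \<in> W\<close> by (auto simp: W_def)
      then have "a \<oplus> b \<in> carrier M" "v \<oplus>\<^bsub>power_module I M\<^esub> w = (\<lambda>i\<in>I. a \<oplus> b)"
        by (auto simp: fun_eq_iff)
      then show ?thesis unfolding W_def by blast
    qed
  qed
  have p: "P.seminorm p"
    unfolding p_def using I L C by (rule seminorm_Max)
  obtain F where F: "P.linear_functional F"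
    and F_W: "\<And>w. w \<in> W \<Longrightarrow> F w = \<phi> (w k)"
    and F_le: "\<And>x. x \<in> carrier (power_module I M) \<Longrightarrow> cmod (F x) \<le> p x"
  proof (rule P.hahn_banach_seminorm[OF p W, of "\<lambda>w. \<phi> (w k)"])
    show "cmod (\<phi> (w k)) \<le> p w" if "w \<in> W" for w
      using that k \<phi>_le by (auto simp: W_def p_def cong: image_cong)
  qed (use k \<phi> in \<open>auto simp: W_def linear_functional_def\<close>)
  \<comment> \<open>The inclusion of the \<open>i\<close>-th factor; \<open>\<psi> i\<close> is the
    restriction of the extension \<open>F\<close> to that factor.\<close>
  define e where "e i a = (\<lambda>j\<in>I. if j = i then a else \<zero>)" for i a
  have e: "e i a \<in> carrier (power_module I M)" if "a \<in> carrier M" for i a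
    using that by (auto simp: e_def)
  define \<psi> where "\<psi> i a = F (e i a)" for i a
  have F_sum: "F x = (\<Sum>i\<in>I. \<psi> i (x i))" if "x \<in> carrier (power_module I M)" for x
    using linear_functional_power_module[OF I(1) F] that by (simp add: \<psi>_def e_def)
  have linear: "linear_functional (\<psi> i)" for i
    unfolding linear_functional_def
  proof (intro conjI ballI allI)
    fix a b assume ab: "a \<in> carrier M" "b \<in> carrier M"
    have "e i (a \<oplus> b) = e i a \<oplus>\<^bsub>power_module I M\<^esub> e i b"
      using ab by (auto simp: e_def fun_eq_iff)
    then show "\<psi> i (a \<oplus> b) = \<psi> i a + \<psi> i b"
      using F e ab unfolding \<psi>_def P.linear_functional_def by metis
  next
    fix c a assume a: "a \<in> carrier M"
    have "e i (c \<odot> a) = c \<odot>\<^bsub>power_module I M\<^esub> e i a"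
      using a by (auto simp: e_def fun_eq_iff)
    then show "\<psi> i (c \<odot> a) = c * \<psi> i a"
      using F e a unfolding \<psi>_def P.linear_functional_def by metis
  qed
  moreover have "\<phi> a = (\<Sum>i\<in>I. \<psi> i a)" if a: "a \<in> carrier M" for a
  proof -
    have "\<phi> a = F (\<lambda>i\<in>I. a)"
      using F_W[of "\<lambda>i\<in>I. a"] a k by (simp add: W_def)
    also have "\<dots> = (\<Sum>i\<in>I. \<psi> i a)"
      using a by (subst F_sum) auto
    finally show ?thesis .
  qed
  moreover have "(\<Sum>i\<in>I. cmod (\<psi> i (x i))) \<le> C * (MAX i\<in>I. L i (x i))" if "x \<in> I \<rightarrow> carrier M" for x
  proof -
    have x: "x i \<in> carrier M" if "i \<in> I" for i using \<open>x \<in> I \<rightarrow> carrier M\<close> that by auto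
    \<comment> \<open>Unimodular factors making all summands of \<open>F y\<close> nonnegative
      reals. The value 1 for vanishing \<open>\<psi> i (x i)\<close> keeps the modulus equal to 1,
      so that \<open>p\<close> does not change between \<open>x\<close> and
      \<open>y\<close>.\<close>
    define c where
      "c i = (if \<psi> i (x i) = 0 then 1 else cnj (\<psi> i (x i)) / complex_of_real (cmod (\<psi> i (x i))))" for i
    have c: "cmod (c i) = 1" "c i * \<psi> i (x i) = complex_of_real (cmod (\<psi> i (x i)))" for i
      by (auto simp: c_def norm_divide complex_norm_square[symmetric] power2_eq_square mult.commute)
    define y where "y = (\<lambda>i\<in>I. c i \<odot> x i)"
    have y: "y \<in> carrier (power_module I M)" using x by (auto simp: y_def)
    have "F y = (\<Sum>i\<in>I. complex_of_real (cmod (\<psi> i (x i))))"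
      unfolding F_sum[OF y] using x linear
      by (intro sum.cong) (auto simp: y_def c linear_functional_def)
    then have "F y = complex_of_real (\<Sum>i\<in>I. cmod (\<psi> i (x i)))" by simp
    then have "(\<Sum>i\<in>I. cmod (\<psi> i (x i))) = cmod (F y)"
      by (simp add: sum_nonneg del: of_real_sum)
    also have "\<dots> \<le> p y" using F_le[OF y] .
    also have "p y = C * (MAX i\<in>I. L i (x i))"
      using L x by (simp add: p_def y_def seminorm_def c cong: image_cong)
    finally show ?thesis .
  qed
  ultimately show ?thesis by (intro that)
qed

end

subsection \<open>Closed spans and the distance to a subspace\<close>

lemma (in complex_module) smult_diff:
  assumes "x \<in> carrier M" "y \<in> carrier M"
  shows "c \<odot> (x \<ominus> y) = c \<odot> x \<ominus> c \<odot> y"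
proof -
  have "c \<odot> (x \<ominus> y) = c \<odot> x \<oplus> c \<odot> ((- 1) \<odot> y)"
    using assms by (simp add: a_minus_def smult_r_distr smult_minus_1)
  also have "c \<odot> ((- 1) \<odot> y) = \<ominus> (c \<odot> y)"
    using assms by (simp add: smult_assoc smult_minus_1[symmetric])
  finally show ?thesis by (simp add: a_minus_def)
qed

lemma (in complex_module) linear_functional_diff:
  assumes "linear_functional f" "x \<in> carrier M" "y \<in> carrier M"
  shows "f (x \<ominus> y) = f x - f y"
proof -
  have "f (x \<oplus> (- 1) \<odot> y) = f x + f ((- 1) \<odot> y)" "f ((- 1) \<odot> y) = - 1 * f y"
    using assms smult_closed[of "- 1" y] unfolding linear_functional_def by (simp, blast)
  then show ?thesis
    using assms by (simp add: a_minus_def smult_minus_1)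
qed

sublocale complex_normed_space \<subseteq> complex_module M
  by unfold_locales

context complex_normed_space
begin

sublocale MS: Metric_space "carrier M" "norm_dist M nrm"
  by (rule Metric_space_norm_dist)

lemma nrm_zero: "nrm \<zero> = 0"
  by (simp add: nrm_eq_0_iff)

lemma in_closure_iff:
  assumes "N \<subseteq> carrier M"
  shows "x \<in> norm_topology M nrm closure_of N \<longleftrightarrow>
    x \<in> carrier M \<and> (\<forall>e>0. \<exists>y\<in>N. nrm (x \<ominus> y) < e)"
  using assms by (fastforce simp: MS.metric_closure_of norm_dist_def)

lemma submodule_closure:
  assumes N: "submodule N complex_ring M"
  shows "submodule (norm_topology M nrm closure_of N) complex_ring M"
proof -
  have sub: "N \<subseteq> carrier M" and ne: "N \<noteq> {}"
    and add: "\<And>x y. \<lbrakk>x \<in> N; y \<in> N\<rbrakk> \<Longrightarrow> x \<oplus> y \<in> N"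
    and smult: "\<And>c x. x \<in> N \<Longrightarrow> c \<odot> x \<in> N"
    using submoduleE[OF N] by auto
  let ?C = "norm_topology M nrm closure_of N"
  have smult_C: "c \<odot> x \<in> ?C" if x: "x \<in> ?C" for c x
  proof -
    have xc: "x \<in> carrier M" using x sub by (simp add: in_closure_iff)
    have "\<exists>y\<in>N. nrm (c \<odot> x \<ominus> y) < e" if e: "0 < e" for e
    proof -
      \<comment> \<open>The added 1 keeps the denominator positive for \<open>c = 0\<close>.\<close>
      have "0 < e / (cmod c + 1)" using e by (simp add: add_nonneg_pos)
      then obtain y where y: "y \<in> N" "nrm (x \<ominus> y) < e / (cmod c + 1)"
        using x sub in_closure_iff by blast
      have yc: "y \<in> carrier M" using y sub by blast
      have "nrm (c \<odot> x \<ominus> c \<odot> y) = cmod c * nrm (x \<ominus> y)"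
        using xc yc by (simp add: smult_diff[symmetric] nrm_smult)
      also have "\<dots> \<le> cmod c * (e / (cmod c + 1))"
        using y by (intro mult_left_mono) auto
      also have "\<dots> < e"
        using e add_pos_nonneg[OF zero_less_one norm_ge_zero[of c]]
        by (simp add: pos_divide_less_eq algebra_simps)
      finally show ?thesis using smult[OF y(1)] by blast
    qed
    then show ?thesis using xc sub by (simp add: in_closure_iff)
  qed
  show ?thesis
  proof (rule submoduleI)
    show "?C \<subseteq> carrier M" using sub by (auto simp: in_closure_iff)
    have "\<zero> \<in> N" using ne smult[of _ 0] sub by (metis all_not_in_conv smult_0_left subsetD)
    then show "\<zero> \<in> ?C"
      using sub closure_of_subset[of N "norm_topology M nrm"] by auto
    show "c \<odot> x \<in> ?C" if "x \<in> ?C" for c x using smult_C[OF that] .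
    show "\<ominus> x \<in> ?C" if "x \<in> ?C" for x
      using smult_C[OF that, of "- 1"] that sub by (simp add: in_closure_iff smult_minus_1)
    fix x y assume x: "x \<in> ?C" and y: "y \<in> ?C"
    then have c: "x \<in> carrier M" "y \<in> carrier M" using sub by (simp_all add: in_closure_iff)
    have "\<exists>z\<in>N. nrm (x \<oplus> y \<ominus> z) < e" if e: "0 < e" for e
    proof -
      obtain v w where vw: "v \<in> N" "nrm (x \<ominus> v) < e / 2" "w \<in> N" "nrm (y \<ominus> w) < e / 2"
        using x y sub in_closure_iff half_gt_zero[OF e] by meson
      have c': "v \<in> carrier M" "w \<in> carrier M" using vw sub by auto
      have "x \<oplus> y \<ominus> (v \<oplus> w) = (x \<ominus> v) \<oplus> (y \<ominus> w)"
        using c c' by (simp add: a_minus_def M.minus_add M.a_ac)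
      then have "nrm (x \<oplus> y \<ominus> (v \<oplus> w)) \<le> nrm (x \<ominus> v) + nrm (y \<ominus> w)"
        using c c' by (simp add: nrm_triangle)
      also have "\<dots> < e" using vw by simp
      finally show ?thesis using add vw by blast
    qed
    then show "x \<oplus> y \<in> ?C" using c sub by (simp add: in_closure_iff)
  qed
qed

text \<open>The hull is an intersection of submodules. Since \<open>S\<close> lies in the carrier,
  the carrier is one of them, which keeps the intersection inside it.\<close>

lemma submodule_hull:
  assumes "S \<subseteq> carrier M"
  shows "submodule ((\<lambda>N. submodule N complex_ring M) hull S) complex_ring M"
proof (rule submoduleI)
  let ?H = "(\<lambda>N. submodule N complex_ring M) hull S"
  show sub: "?H \<subseteq> carrier M"
    using assms carrier_is_submodule by (rule hull_minimal)
  show smult: "c \<odot> x \<in> ?H" if "x \<in> ?H" for c x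
    using that submoduleE(4) unfolding hull_def by fastforce
  show "x \<oplus> y \<in> ?H" if "x \<in> ?H" "y \<in> ?H" for x y
    using that submoduleE(5) unfolding hull_def by fastforce
  show "\<ominus> x \<in> ?H" if "x \<in> ?H" for x
    using that submoduleE(3) unfolding hull_def by fastforce
  have "\<zero> \<in> N" if "submodule N complex_ring M" for N
    using submoduleE(1,2,4)[OF that] smult_0_left
    by (metis UNIV_I all_not_in_conv complex_ring_simps(1) subsetD)
  then show "\<zero> \<in> ?H"
    unfolding hull_def by blast
qed

lemma submodule_closed_span:
  "S \<subseteq> carrier M \<Longrightarrow> submodule (closed_span M nrm S) complex_ring M"
  unfolding closed_span_def by (intro submodule_closure submodule_hull)

lemma closed_span_superset:
  assumes S: "S \<subseteq> carrier M" and x: "x \<in> S"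
  shows "x \<in> closed_span M nrm S"
proof -
  let ?H = "(\<lambda>N. submodule N complex_ring M) hull S"
  have "?H \<subseteq> norm_topology M nrm closure_of ?H"
    using submoduleE(1)[OF submodule_hull[OF S]] by (intro closure_of_subset) simp
  then show ?thesis
    using x unfolding closed_span_def by (blast intro: hull_inc)
qed

text \<open>The infimum is the quotient norm of \<open>a\<close> modulo \<open>N\<close>. It is well
  behaved in the reals because norms are bounded below by 0 and \<open>N\<close> contains
  zero.\<close>

lemma
  assumes N: "submodule N complex_ring M" and a: "a \<in> carrier M"
  shows dist_le: "c \<in> N \<Longrightarrow> (INF c\<in>N. nrm (a \<ominus> c)) \<le> nrm (a \<ominus> c)"
    and dist_nonneg: "0 \<le> (INF c\<in>N. nrm (a \<ominus> c))"
    and dist_le_nrm: "(INF c\<in>N. nrm (a \<ominus> c)) \<le> nrm a"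
    and dist_eq_0: "a \<in> N \<Longrightarrow> (INF c\<in>N. nrm (a \<ominus> c)) = 0"
proof -
  have sub: "N \<subseteq> carrier M" and ne: "N \<noteq> {}" using submoduleE(1,2)[OF N] by auto
  then have nn: "0 \<le> nrm (a \<ominus> c)" if "c \<in> N" for c
    using a that by (auto intro!: nrm_nonneg)
  show le: "(INF c\<in>N. nrm (a \<ominus> c)) \<le> nrm (a \<ominus> c)" if "c \<in> N" for c
    using nn that by (intro cINF_lower bdd_belowI2) auto
  show ge: "0 \<le> (INF c\<in>N. nrm (a \<ominus> c))"
    using ne nn by (intro cINF_greatest)
  have "\<zero> \<in> N"
    using submoduleE(4)[OF N, of 0] ne sub by (metis UNIV_I all_not_in_conv complex_ring_simps(1)
        smult_0_left subsetD)
  moreover have "a \<ominus> \<zero> = a"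
    using a by (simp add: a_minus_def M.minus_equality)
  ultimately show "(INF c\<in>N. nrm (a \<ominus> c)) \<le> nrm a"
    using le[of \<zero>] by simp
  show "(INF c\<in>N. nrm (a \<ominus> c)) = 0" if "a \<in> N"
    using le[OF that] ge a by (simp add: a_minus_def M.r_neg nrm_zero)
qed

text \<open>The quotient seminorm of \<open>M\<close> modulo \<open>N\<close>: approximants from
  \<open>N\<close> can be added and scaled without leaving \<open>N\<close>. Homogeneity for nonzero
  \<open>c\<close> follows from one inequality applied to \<open>c\<close> and to its
  inverse.\<close>

lemma seminorm_dist:
  assumes N: "submodule N complex_ring M"
  shows "seminorm (\<lambda>a. INF c\<in>N. nrm (a \<ominus> c))"
proof -
  define d where "d a = (INF c\<in>N. nrm (a \<ominus> c))" for a
  have sub: "N \<subseteq> carrier M" and ne: "N \<noteq> {}"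
    and add: "\<And>x y. \<lbrakk>x \<in> N; y \<in> N\<rbrakk> \<Longrightarrow> x \<oplus> y \<in> N"
    and smult: "\<And>c x. x \<in> N \<Longrightarrow> c \<odot> x \<in> N"
    using submoduleE[OF N] by auto
  have le: "d a \<le> nrm (a \<ominus> c)" if "a \<in> carrier M" "c \<in> N" for a c
    unfolding d_def using dist_le[OF N] that by blast
  have ge: "r \<le> d a" if "\<And>c. c \<in> N \<Longrightarrow> r \<le> nrm (a \<ominus> c)" for a r
    unfolding d_def using ne that by (intro cINF_greatest)
  have d_add: "d (x \<oplus> y) \<le> d x + d y" if c: "x \<in> carrier M" "y \<in> carrier M" for x y
  proof -
    have *: "d (x \<oplus> y) \<le> nrm (x \<ominus> v) + nrm (y \<ominus> w)" if vw: "v \<in> N" "w \<in> N" for v w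
    proof -
      have c': "v \<in> carrier M" "w \<in> carrier M" using vw sub by auto
      have "x \<oplus> y \<ominus> (v \<oplus> w) = (x \<ominus> v) \<oplus> (y \<ominus> w)"
        using c c' by (simp add: a_minus_def M.minus_add M.a_ac)
      then have "nrm (x \<oplus> y \<ominus> (v \<oplus> w)) \<le> nrm (x \<ominus> v) + nrm (y \<ominus> w)"
        using c c' by (simp add: nrm_triangle)
      with le[of "x \<oplus> y" "v \<oplus> w"] c add[OF vw] show ?thesis by simp
    qed
    have "d (x \<oplus> y) - d y \<le> d x"
    proof (rule ge)
      fix v assume v: "v \<in> N"
      have "d (x \<oplus> y) - nrm (x \<ominus> v) \<le> d y"
        using *[OF v] by (intro ge) (simp add: diff_le_eq add.commute)
      then show "d (x \<oplus> y) - d y \<le> nrm (x \<ominus> v)" by simp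
    qed
    then show ?thesis by simp
  qed
  have scale_le: "d (c \<odot> x) \<le> cmod c * d x" if x: "x \<in> carrier M" and c: "c \<noteq> 0" for c x
  proof -
    have c0: "0 < cmod c" using c by simp
    have "d (c \<odot> x) / cmod c \<le> d x"
    proof (rule ge)
      fix v assume v: "v \<in> N"
      then have "d (c \<odot> x) \<le> nrm (c \<odot> x \<ominus> c \<odot> v)"
        using x smult by (intro le) auto
      also have "\<dots> = nrm (x \<ominus> v) * cmod c"
        using x v sub by (simp add: smult_diff[symmetric] nrm_smult subsetD)
      finally show "d (c \<odot> x) / cmod c \<le> nrm (x \<ominus> v)"
        by (simp only: pos_divide_le_eq[OF c0])
    qed
    then show ?thesis by (simp only: pos_divide_le_eq[OF c0] mult.commute)
  qed
  have "d (c \<odot> x) = cmod c * d x" if x: "x \<in> carrier M" for c x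
  proof (cases "c = 0")
    case True
    have "0 \<le> d \<zero>" "d \<zero> \<le> nrm \<zero>"
      unfolding d_def using dist_nonneg[OF N] dist_le_nrm[OF N] by blast+
    then show ?thesis using True x by (simp add: smult_0_left nrm_zero)
  next
    case False
    have "d (inverse c \<odot> (c \<odot> x)) \<le> cmod (inverse c) * d (c \<odot> x)"
      using False x by (intro scale_le) auto
    also have "inverse c \<odot> (c \<odot> x) = x"
      using False x by (simp add: smult_assoc smult_1)
    finally have "cmod c * d x \<le> cmod c * (cmod (inverse c) * d (c \<odot> x))"
      by (rule mult_left_mono) simp
    also have "\<dots> = d (c \<odot> x)"
      using False by (simp add: mult.assoc[symmetric] norm_mult[symmetric])
    finally show ?thesis using scale_le[OF x False] by simp
  qed
  with d_add have "seminorm d" by (simp add: seminorm_def)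
  then show ?thesis by (simp add: d_def[abs_def])
qed

lemma continuous_map_linear_functional:
  assumes f: "linear_functional f" and C: "\<And>x. x \<in> carrier M \<Longrightarrow> cmod (f x) \<le> C * nrm x"
  shows "continuous_map (norm_topology M nrm) euclidean f"
proof -
  have "\<exists>\<delta>>0. \<forall>y. y \<in> carrier M \<and> norm_dist M nrm x y < \<delta> \<longrightarrow> dist (f x) (f y) < e"
    if x: "x \<in> carrier M" and e: "0 < e" for x e
  \<comment> \<open>The functional is Lipschitz; the constant \<open>\<bar>C\<bar> + 1\<close> is
    positive whatever the sign of \<open>C\<close>.\<close>
  proof (intro exI[of _ "e / (\<bar>C\<bar> + 1)"] conjI allI impI)
    show "0 < e / (\<bar>C\<bar> + 1)" using e by (simp add: add_nonneg_pos)
    fix y assume y: "y \<in> carrier M \<and> norm_dist M nrm x y < e / (\<bar>C\<bar> + 1)"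
    then have xy: "x \<ominus> y \<in> carrier M" "nrm (x \<ominus> y) < e / (\<bar>C\<bar> + 1)"
      using x by (auto simp: norm_dist_def)
    have "dist (f x) (f y) = cmod (f (x \<ominus> y))"
      using x y f by (simp add: linear_functional_diff dist_norm)
    also have "\<dots> \<le> (\<bar>C\<bar> + 1) * nrm (x \<ominus> y)"
      using C[OF xy(1)] nrm_nonneg[OF xy(1)]
      by (smt (verit, best) mult_right_mono)
    also have "\<dots> < e"
      using xy(2) by (simp add: pos_less_divide_eq add_nonneg_pos mult.commute)
    finally show "dist (f x) (f y) < e" .
  qed
  then show ?thesis
    using MS.metric_continuous_map[OF Met_TC.Metric_space_axioms, of f] by simp
qed

end

subsection \<open>The norm of a Hilbert space and the unit of the tensor product\<close>

context hilbert_space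
begin

sublocale complex_module H
  by unfold_locales

lemma inner_prod_add_right:
  assumes "x \<in> carrier H" "y \<in> carrier H" "z \<in> carrier H"
  shows "inner_prod H x (y \<oplus> z) = inner_prod H x y + inner_prod H x z"
  using assms inner_prod_commute[of "y \<oplus> z" x] inner_prod_commute[of y x] inner_prod_commute[of z x]
  by (simp add: inner_prod_add_left)

lemma inner_prod_smult_right:
  assumes "x \<in> carrier H" "y \<in> carrier H"
  shows "inner_prod H x (c \<odot> y) = cnj c * inner_prod H x y"
  using assms inner_prod_commute[of "c \<odot> y" x] inner_prod_commute[of y x]
  by (simp add: inner_prod_smult_left)

lemma hnorm_nonneg: "x \<in> carrier H \<Longrightarrow> 0 \<le> hnorm H x"
  by (simp add: hnorm_def inner_prod_nonneg)

lemma hnorm_square: "x \<in> carrier H \<Longrightarrow> (hnorm H x)\<^sup>2 = Re (inner_prod H x x)"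
  by (simp add: hnorm_def inner_prod_nonneg)

lemma inner_prod_self: "x \<in> carrier H \<Longrightarrow> inner_prod H x x = complex_of_real ((hnorm H x)\<^sup>2)"
  using inner_prod_commute[of x x] by (simp add: hnorm_square complex_eq_iff)

lemma hnorm_eq_0: "x \<in> carrier H \<Longrightarrow> hnorm H x = 0 \<Longrightarrow> x = \<zero>"
  using inner_prod_eq_0[of x] by (simp add: inner_prod_self)

lemma hnorm_smult: "x \<in> carrier H \<Longrightarrow> hnorm H (c \<odot> x) = cmod c * hnorm H x"
proof -
  assume x: "x \<in> carrier H"
  have "inner_prod H (c \<odot> x) (c \<odot> x) = (c * cnj c) * inner_prod H x x"
    using x by (simp add: inner_prod_smult_left inner_prod_smult_right)
  also have "\<dots> = complex_of_real ((cmod c * hnorm H x)\<^sup>2)"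
    using x by (simp add: inner_prod_self complex_norm_square[symmetric] power_mult_distrib)
  finally have "(hnorm H (c \<odot> x))\<^sup>2 = (cmod c * hnorm H x)\<^sup>2"
    using x by (simp add: hnorm_square)
  then show ?thesis
    using x by (simp add: power2_eq_iff_nonneg hnorm_nonneg)
qed

text \<open>Cauchy-Schwarz for the real part, which is all that the triangle inequality needs. It
  follows from nonnegativity of the squared norm of \<open>s x - r y\<close> with \<open>r\<close>
  and \<open>s\<close> the norms of \<open>x\<close> and \<open>y\<close>; the degenerate case is
  treated apart because the factor \<open>r * s\<close> is cancelled.\<close>

lemma Re_inner_prod_le:
  assumes x: "x \<in> carrier H" and y: "y \<in> carrier H"
  shows "Re (inner_prod H x y) \<le> hnorm H x * hnorm H y"
proof (cases "hnorm H x * hnorm H y = 0")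
  case True
  have zero_left: "inner_prod H \<zero> z = 0" if "z \<in> carrier H" for z
    using that inner_prod_smult_left[of \<zero> z 0] by (simp add: smult_0_left)
  have "x = \<zero> \<or> y = \<zero>"
    using True x y hnorm_eq_0 by auto
  then have zero: "inner_prod H x y = 0"
    using x y zero_left inner_prod_commute[of y x] by auto
  show ?thesis by (simp only: True zero zero_complex.sel order_refl)
next
  case False
  define r s where "r = hnorm H x" and "s = hnorm H y"
  have rs: "0 < r * s"
    using False x y hnorm_nonneg by (simp add: r_def s_def less_le)
  let ?z = "complex_of_real s \<odot> x \<oplus> complex_of_real (- r) \<odot> y"
  have "inner_prod H ?z ?z =
      complex_of_real (s * s) * inner_prod H x x + complex_of_real (r * r) * inner_prod H y y
      - complex_of_real (r * s) * (inner_prod H x y + inner_prod H y x)"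
    using x y by (simp add: inner_prod_add_left inner_prod_add_right inner_prod_smult_left
        inner_prod_smult_right algebra_simps)
  then have "Re (inner_prod H ?z ?z) =
      s * s * Re (inner_prod H x x) + r * r * Re (inner_prod H y y)
      - r * s * (Re (inner_prod H x y) + Re (inner_prod H y x))"
    by (simp only: minus_complex.sel plus_complex.sel Re_complex_of_real times_complex.sel
        Im_complex_of_real mult_zero_left diff_zero)
  moreover have "Re (inner_prod H y x) = Re (inner_prod H x y)"
    "Re (inner_prod H x x) = r * r" "Re (inner_prod H y y) = s * s"
    using inner_prod_commute[OF x y] hnorm_square[OF x] hnorm_square[OF y]
    by (simp_all add: r_def s_def power2_eq_square)
  ultimately have "Re (inner_prod H ?z ?z) = 2 * (r * s) * (r * s - Re (inner_prod H x y))"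
    by (simp only:) (simp add: algebra_simps)
  moreover have "0 \<le> Re (inner_prod H ?z ?z)"
    using x y by (intro inner_prod_nonneg) simp
  ultimately have "0 \<le> r * s - Re (inner_prod H x y)"
    using rs by (simp add: zero_le_mult_iff)
  then show ?thesis by (simp add: r_def s_def)
qed

text \<open>This makes the description of closures by approximation available in Hilbert
  spaces.\<close>

lemma complex_normed_space_hnorm: "complex_normed_space H (hnorm H)"
proof (unfold_locales)
  fix x y assume x: "x \<in> carrier H" and y: "y \<in> carrier H"
  have "(hnorm H (x \<oplus> y))\<^sup>2 = (hnorm H x)\<^sup>2 + 2 * Re (inner_prod H x y) + (hnorm H y)\<^sup>2"
    using x y inner_prod_commute[of x y]
    by (simp add: hnorm_square inner_prod_add_left inner_prod_add_right)
  also have "\<dots> \<le> (hnorm H x + hnorm H y)\<^sup>2"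
    using Re_inner_prod_le[OF x y] by (simp add: power2_sum)
  finally show "hnorm H (x \<oplus> y) \<le> hnorm H x + hnorm H y"
    using x y by (auto intro: power2_le_imp_le simp: hnorm_nonneg)
next
  show "hnorm H x = 0 \<longleftrightarrow> x = \<zero>" if "x \<in> carrier H" for x
    using that hnorm_eq_0 hnorm_smult[of \<zero> 0] by (auto simp: smult_0_left)
qed (simp_all add: hnorm_nonneg hnorm_smult)

end

text \<open>The operator of the elementary tensor of units fixes all elementary tensors of vectors,
  hence by linearity and boundedness every vector. The isometric representation then identifies it
  with the unit. This places the unit of \<open>T\<close> in every omitting subalgebra.\<close>

lemma min_tensor_product_one:
  fixes I :: "'i set" and A :: "'i \<Rightarrow> 'a cstar" and T :: "'b cstar"
  assumes A: "\<And>i. i \<in> I \<Longrightarrow> unital_cstar_algebra (A i)"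
    and T: "min_tensor_product TYPE('h) TYPE('k) I A T tens"
  shows "tens (\<lambda>i\<in>I. \<one>\<^bsub>A i\<^esub>) = \<one>\<^bsub>T\<^esub>"
proof -
  have alg: "unital_cstar_algebra T"
    and tens: "tens \<in> (\<Pi>\<^sub>E i\<in>I. carrier (A i)) \<rightarrow> carrier T"
    using T by (simp_all add: min_tensor_product_def)
  obtain H :: "'i \<Rightarrow> 'h hilbert" and \<pi> and K :: "'k hilbert" and t \<rho>
    where \<pi>: "\<forall>i\<in>I. hilbert_space (H i) \<and> faithful_representation (A i) (H i) (\<pi> i)"
    and HK: "hilbert_tensor_product I H K t"
    and \<rho>: "star_representation T K \<rho>"
    and isometric: "\<forall>x\<in>carrier T. operator_norm K (\<rho> x) = cnorm T x"
    and \<rho>_tens: "\<forall>a\<in>\<Pi>\<^sub>E i\<in>I. carrier (A i). \<forall>\<xi>\<in>\<Pi>\<^sub>E i\<in>I. carrier (H i).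
      \<rho> (tens a) (t \<xi>) = t (\<lambda>i\<in>I. \<pi> i (a i) (\<xi> i))"
    using T unfolding min_tensor_product_def by (elim conjE exE) (rule that)
  interpret T: unital_cstar_algebra T by (rule alg)
  interpret K: hilbert_space K using HK by (simp add: hilbert_tensor_product_def)
  interpret KN: complex_normed_space K "hnorm K" by (rule K.complex_normed_space_hnorm)
  have t: "t \<in> (\<Pi>\<^sub>E i\<in>I. carrier (H i)) \<rightarrow> carrier K"
    and span: "closed_span K (hnorm K) (t ` (\<Pi>\<^sub>E i\<in>I. carrier (H i))) = carrier K"
    using HK by (simp_all add: hilbert_tensor_product_def)
  define one where "one = (\<lambda>i\<in>I. \<one>\<^bsub>A i\<^esub>)"
  have one: "one \<in> (\<Pi>\<^sub>E i\<in>I. carrier (A i))"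
    unfolding one_def using A
    by (auto intro!: monoid.one_closed ring.is_monoid simp: unital_cstar_algebra_def)
  define u where "u = tens one"
  have u: "u \<in> carrier T" using tens one by (auto simp: u_def)
  have op: "bounded_operator K (\<rho> u)" using \<rho> u by (simp add: star_representation_def)
  have \<rho>_closed: "\<rho> u x \<in> carrier K" if "x \<in> carrier K" for x
    using op that by (auto simp: bounded_operator_def)
  have \<rho>_add: "\<rho> u (x \<oplus>\<^bsub>K\<^esub> y) = \<rho> u x \<oplus>\<^bsub>K\<^esub> \<rho> u y" if "x \<in> carrier K" "y \<in> carrier K" for x y
    using op that by (simp add: bounded_operator_def)
  have \<rho>_smult: "\<rho> u (c \<odot>\<^bsub>K\<^esub> x) = c \<odot>\<^bsub>K\<^esub> \<rho> u x" if "x \<in> carrier K" for c x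
    using op that by (simp add: bounded_operator_def)
  obtain B where B: "\<And>x. x \<in> carrier K \<Longrightarrow> hnorm K (\<rho> u x) \<le> B * hnorm K x"
    using op unfolding bounded_operator_def by blast
  define D where "D x = \<rho> u x \<ominus>\<^bsub>K\<^esub> x" for x
  have D_closed: "D x \<in> carrier K" if "x \<in> carrier K" for x
    using that \<rho>_closed by (simp add: D_def)
  have D_diff: "D (x \<ominus>\<^bsub>K\<^esub> y) = D x \<ominus>\<^bsub>K\<^esub> D y" if "x \<in> carrier K" "y \<in> carrier K" for x y
  proof -
    have "\<rho> u (x \<ominus>\<^bsub>K\<^esub> y) = \<rho> u x \<ominus>\<^bsub>K\<^esub> \<rho> u y"
      using \<rho>_add[of x "(- 1) \<odot>\<^bsub>K\<^esub> y"] \<rho>_smult[of y "- 1"] that \<rho>_closed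
      by (simp add: a_minus_def K.smult_minus_1)
    then show ?thesis
      using that \<rho>_closed by (simp add: D_def a_minus_def K.M.minus_add K.M.a_ac)
  qed
  define N where "N = {x \<in> carrier K. \<rho> u x = x}"
  have "submodule N complex_ring K"
  proof (rule K.submoduleI)
    show smult: "c \<odot>\<^bsub>K\<^esub> x \<in> N" if "x \<in> N" for c x
      using that \<rho>_smult by (simp add: N_def)
    show "\<ominus>\<^bsub>K\<^esub> x \<in> N" if "x \<in> N" for x
      using smult[OF that, of "- 1"] that by (simp add: N_def K.smult_minus_1)
    show "\<zero>\<^bsub>K\<^esub> \<in> N"
      using \<rho>_smult[of "\<zero>\<^bsub>K\<^esub>" 0] \<rho>_closed by (simp add: N_def K.smult_0_left)
  qed (use \<rho>_add in \<open>auto simp: N_def\<close>)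
  moreover have "t ` (\<Pi>\<^sub>E i\<in>I. carrier (H i)) \<subseteq> N"
  proof
    fix x assume "x \<in> t ` (\<Pi>\<^sub>E i\<in>I. carrier (H i))"
    then obtain \<xi> where \<xi>: "\<xi> \<in> (\<Pi>\<^sub>E i\<in>I. carrier (H i))" "x = t \<xi>" by auto
    have "(\<lambda>i\<in>I. \<pi> i (one i) (\<xi> i)) = \<xi>"
      using \<xi>(1) \<pi>
      by (auto simp: one_def faithful_representation_def star_representation_def PiE_iff
          extensional_def fun_eq_iff)
    then show "x \<in> N"
      using \<rho>_tens one \<xi> t by (auto simp: N_def u_def)
  qed
  ultimately have hull: "(\<lambda>N. submodule N complex_ring K) hull (t ` (\<Pi>\<^sub>E i\<in>I. carrier (H i))) \<subseteq> N"
    by (intro hull_minimal)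
  \<comment> \<open>The operator \<open>D\<close> is bounded with constant
    \<open>\<bar>B\<bar> + 1\<close> and vanishes on \<open>N\<close>, which is dense because it
    contains the hull; thus \<open>D x\<close> is as small as desired.\<close>
  have fixed: "\<rho> u x = x" if x: "x \<in> carrier K" for x
  proof -
    have "hnorm K (D x) \<le> e" if e: "0 < e" for e
    proof -
      define e' where "e' = e / (\<bar>B\<bar> + 1)"
      have e': "0 < e'" using e by (simp add: e'_def add_nonneg_pos)
      have "x \<in> norm_topology K (hnorm K) closure_of
          ((\<lambda>N. submodule N complex_ring K) hull (t ` (\<Pi>\<^sub>E i\<in>I. carrier (H i))))"
        using span x by (simp add: closed_span_def)
      then obtain y where y: "y \<in> N" "hnorm K (x \<ominus>\<^bsub>K\<^esub> y) < e'"
        using KN.in_closure_iff[of "(\<lambda>N. submodule N complex_ring K) hull (t ` (\<Pi>\<^sub>E i\<in>I. carrier (H i)))" x]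
          hull e' by (fastforce simp: N_def)
      have yc: "y \<in> carrier K" "D y = \<zero>\<^bsub>K\<^esub>"
        using y(1) by (simp_all add: N_def D_def a_minus_def K.M.r_neg)
      define z where "z = x \<ominus>\<^bsub>K\<^esub> y"
      have z: "z \<in> carrier K" "hnorm K z < e'" using x yc y by (simp_all add: z_def)
      have "D x = D z"
        using D_diff[of x y] x yc D_closed by (simp add: z_def a_minus_def K.M.minus_equality)
      also have "hnorm K (D z) \<le> hnorm K (\<rho> u z) + hnorm K ((- 1) \<odot>\<^bsub>K\<^esub> z)"
        using z \<rho>_closed KN.nrm_triangle[of "\<rho> u z" "(- 1) \<odot>\<^bsub>K\<^esub> z"]
        by (simp add: D_def a_minus_def K.smult_minus_1)
      also have "\<dots> \<le> (\<bar>B\<bar> + 1) * hnorm K z"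
      proof -
        have "B * hnorm K z \<le> \<bar>B\<bar> * hnorm K z"
          using K.hnorm_nonneg[OF z(1)] by (intro mult_right_mono) auto
        then show ?thesis
          using B[OF z(1)] K.hnorm_smult[OF z(1), of "- 1"] by (simp add: algebra_simps)
      qed
      also have "\<dots> \<le> (\<bar>B\<bar> + 1) * e'"
        using z by (intro mult_left_mono) auto
      also have "\<dots> = e"
        by (simp add: e'_def)
      finally show ?thesis .
    qed
    then have "hnorm K (D x) \<le> 0" by (rule field_le_epsilon[where y = 0, simplified])
    then show ?thesis
      using K.hnorm_nonneg[OF D_closed[OF x]] x \<rho>_closed[OF x] KN.MS.zero[of "\<rho> u x" x]
      by (simp add: D_def norm_dist_def)
  qed
  have zero: "hnorm K (\<rho> (u \<ominus>\<^bsub>T\<^esub> \<one>\<^bsub>T\<^esub>) x) = 0" if x: "x \<in> carrier K" for x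
  proof -
    have "\<rho> (u \<oplus>\<^bsub>T\<^esub> (- 1) \<odot>\<^bsub>T\<^esub> \<one>\<^bsub>T\<^esub>) x = \<rho> u x \<oplus>\<^bsub>K\<^esub> (- 1) \<odot>\<^bsub>K\<^esub> \<rho> \<one>\<^bsub>T\<^esub> x"
      using \<rho> u x T.smult_closed[of "- 1" "\<one>\<^bsub>T\<^esub>"] unfolding star_representation_def by simp
    also have "\<dots> = \<zero>\<^bsub>K\<^esub>"
      using \<rho> x fixed[OF x] by (simp add: star_representation_def K.smult_minus_1 K.M.r_neg)
    finally show ?thesis by (simp add: a_minus_def T.smult_minus_1 KN.nrm_zero)
  qed
  have "operator_norm K (\<rho> (u \<ominus>\<^bsub>T\<^esub> \<one>\<^bsub>T\<^esub>)) = (SUP x\<in>{x \<in> carrier K. hnorm K x \<le> 1}. (0::real))"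
    unfolding operator_norm_def using zero by (intro SUP_cong) auto
  \<comment> \<open>The real supremum of a constant needs a nonempty index set; the zero vector lies
    in the unit ball.\<close>
  also have "\<dots> = 0"
    using KN.nrm_zero by (intro cSUP_const) (auto intro!: exI[of _ "\<zero>\<^bsub>K\<^esub>"])
  finally have "cnorm T (u \<ominus>\<^bsub>T\<^esub> \<one>\<^bsub>T\<^esub>) = 0"
    using isometric u by simp
  then show ?thesis
    using u T.MS.zero[of u "\<one>\<^bsub>T\<^esub>"] by (simp add: norm_dist_def u_def one_def)
qed

text \<open>The variables of the suprema are independent, so the suprema can be taken one at a time.
  If one \<open>S i\<close> were empty, the bound over \<open>Pi I S\<close> would be
  vacuous.\<close>

lemma sum_SUP_le_ennreal:
  fixes f :: "'i \<Rightarrow> 'a \<Rightarrow> ennreal"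
  assumes "finite I" and "\<And>i. i \<in> I \<Longrightarrow> S i \<noteq> {}"
    and "\<And>x. x \<in> Pi I S \<Longrightarrow> (\<Sum>i\<in>I. f i (x i)) \<le> C"
  shows "(\<Sum>i\<in>I. SUP a\<in>S i. f i a) \<le> C"
  using assms
proof (induction I arbitrary: C rule: finite_induct)
  case empty
  then show ?case by simp
next
  case (insert j I)
  have x0: "(\<lambda>i. SOME a. a \<in> S i) \<in> Pi I S"
    using insert.prems(1) by (auto simp: some_in_eq)
  have "(\<Sum>i\<in>insert j I. SUP a\<in>S i. f i a) = (SUP a\<in>S j. f j a + (\<Sum>i\<in>I. SUP a\<in>S i. f i a))"
    using insert.hyps insert.prems(1)[of j] by (simp add: ennreal_SUP_add_left)
  also have "\<dots> \<le> C"
  proof (rule SUP_least)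
    fix a assume a: "a \<in> S j"
    have sum: "f j a + (\<Sum>i\<in>I. f i (x i)) \<le> C" if "x \<in> Pi I S" for x
    proof -
      have "(\<Sum>i\<in>I. f i ((x(j := a)) i)) = (\<Sum>i\<in>I. f i (x i))"
        using insert.hyps by (intro sum.cong) auto
      then show ?thesis
        using insert.prems(2)[of "x(j := a)"] insert.hyps that a by (auto simp: Pi_iff)
    qed
    \<comment> \<open>The induction hypothesis is applied with the lowered constant
      \<open>C - f j a\<close>, which is why \<open>C\<close> is kept arbitrary.\<close>
    have "(\<Sum>i\<in>I. SUP a\<in>S i. f i a) \<le> C - f j a"
      using insert.prems(1) sum by (intro insert.IH) (auto simp: ennreal_le_minus_iff add.commute)
    \<comment> \<open>Subtraction truncates at 0. This inequality settles the degenerate case where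
      the sum of suprema is 0 and \<open>C \<le> f j a\<close>.\<close>
    moreover have "f j a \<le> C"
      using order_trans[OF _ sum[OF x0], of "f j a"] by simp
    ultimately show "f j a + (\<Sum>i\<in>I. SUP a\<in>S i. f i a) \<le> C"
      unfolding ennreal_le_minus_iff by (auto simp: add.commute)
  qed
  finally show ?case .
qed

subsection \<open>The dual of the quantum Hamming seminorm\<close>

theorem theorem11p1:
  fixes I :: "'i set"
    and A :: "'i \<Rightarrow> 'a cstar"
    and T :: "'b cstar"
    and tens :: "('i \<Rightarrow> 'a) \<Rightarrow> 'b"
    and \<phi> :: "'b \<Rightarrow> complex"
  assumes "finite I"
    and "\<And>i. i \<in> I \<Longrightarrow> unital_cstar_algebra (A i)"
    and "min_tensor_product TYPE('h) TYPE('k) I A T tens"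
    and "\<phi> \<in> M0 T"
  shows "dual_norm T (L_qH I A T tens) \<phi> =
    Inf {(\<Sum>i\<in>I. dual_norm T (L_omit I A T tens i) (\<phi>' i)) | \<phi>'.
      (\<forall>i\<in>I. \<phi>' i \<in> annihilator_omitting I A T tens i) \<and>
      (\<forall>a\<in>carrier T. \<phi> a = (\<Sum>i\<in>I. \<phi>' i a))}"
    (is "_ = Inf ?S")
proof (rule antisym)

  \<comment> \<open>Seminorm properties of \<open>L_omit\<close> and \<open>L_qH\<close>\<close>
  note I = assms(1)
  interpret T: unital_cstar_algebra T
    using assms(3) by (simp add: min_tensor_product_def)
  have tens: "tens \<in> (\<Pi>\<^sub>E i\<in>I. carrier (A i)) \<rightarrow> carrier T"
    using assms(3) by (simp add: min_tensor_product_def)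
  let ?L = "L_omit I A T tens" and ?N = "tensor_omitting I A T tens"
  have omit_sub: "{tens a |a. a \<in> (\<Pi>\<^sub>E j\<in>I. carrier (A j)) \<and> a i = \<one>\<^bsub>A i\<^esub>} \<subseteq> carrier T" for i
    using tens by auto
  have N: "submodule (?N i) complex_ring T" for i
    unfolding tensor_omitting_def using omit_sub by (rule T.submodule_closed_span)
  have L: "T.seminorm (?L i)" for i
  proof -
    have "T.seminorm (\<lambda>a. INF c\<in>?N i. cnorm T (a \<ominus>\<^bsub>T\<^esub> c))"
      using N by (rule T.seminorm_dist)
    then show ?thesis
      by (fastforce simp: T.seminorm_def L_omit_def)
  qed
  have L_nonneg: "0 \<le> ?L i a" if "a \<in> carrier T" for i a
    using T.seminorm_nonneg[OF L that] .
  have L_zero: "?L i \<zero>\<^bsub>T\<^esub> = 0" for i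
    using T.sublinear_zero[OF T.seminorm_sublinear[OF L]] .
  have \<phi>: "T.linear_functional \<phi>"
    using assms(4) by (simp add: M0_def T.linear_functional_def)
  have qH_ge: "?L i a \<le> L_qH I A T tens a" if "i \<in> I" for i a
    unfolding L_qH_def using I that by (intro Max_ge) auto

  have qH_seminorm: "T.seminorm (L_qH I A T tens)"
    unfolding T.seminorm_def
  proof (intro conjI ballI allI)
    fix a b assume ab: "a \<in> carrier T" "b \<in> carrier T"
    have "?L i (a \<oplus>\<^bsub>T\<^esub> b) \<le> L_qH I A T tens a + L_qH I A T tens b" if i: "i \<in> I" for i
    proof -
      have "?L i (a \<oplus>\<^bsub>T\<^esub> b) \<le> ?L i a + ?L i b"
        using L ab by (simp add: T.seminorm_def)
      also have "\<dots> \<le> L_qH I A T tens a + L_qH I A T tens b"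
        using i by (intro add_mono qH_ge)
      finally show ?thesis .
    qed
    \<comment> \<open>The right-hand side must also dominate the 0 inserted into the
      maximum.\<close>
    moreover have "0 \<le> L_qH I A T tens c" for c
      unfolding L_qH_def using I by (intro Max_ge) auto
    ultimately show "L_qH I A T tens (a \<oplus>\<^bsub>T\<^esub> b) \<le> L_qH I A T tens a + L_qH I A T tens b"
      unfolding L_qH_def[of I A T tens "a \<oplus>\<^bsub>T\<^esub> b"] using I by (intro Max.boundedI) auto
  next
    fix c a assume a: "a \<in> carrier T"
    have "insert 0 ((\<lambda>i. ?L i (c \<odot>\<^bsub>T\<^esub> a)) ` I) = (\<lambda>r. cmod c * r) ` insert 0 ((\<lambda>i. ?L i a) ` I)"
      using L a by (simp add: T.seminorm_def image_image)
    also have "Max \<dots> = cmod c * Max (insert 0 ((\<lambda>i. ?L i a) ` I))"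
      using I by (intro mono_Max_commute[symmetric]) (auto intro!: monoI mult_left_mono)
    finally show "L_qH I A T tens (c \<odot>\<^bsub>T\<^esub> a) = cmod c * L_qH I A T tens a"
      by (simp only: L_qH_def)
  qed

  \<comment> \<open>Every decomposition bounds the quantum Hamming dual norm\<close>
  show "dual_norm T (L_qH I A T tens) \<phi> \<le> Inf ?S"
  proof (rule Inf_greatest)
    fix s assume "s \<in> ?S"
    then obtain \<phi>' where s: "s = (\<Sum>i\<in>I. dual_norm T (?L i) (\<phi>' i))"
      and \<phi>': "\<And>a. a \<in> carrier T \<Longrightarrow> \<phi> a = (\<Sum>i\<in>I. \<phi>' i a)"
      by blast
    show "dual_norm T (L_qH I A T tens) \<phi> \<le> s"
      unfolding dual_norm_def[of T "L_qH I A T tens"]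
    proof (rule SUP_least)
      fix a assume a: "a \<in> {a \<in> carrier T. L_qH I A T tens a \<le> 1}"
      have "ennreal (cmod (\<phi> a)) \<le> ennreal (\<Sum>i\<in>I. cmod (\<phi>' i a))"
        using a \<phi>' by (intro ennreal_leI) (simp add: norm_sum)
      also have "\<dots> = (\<Sum>i\<in>I. ennreal (cmod (\<phi>' i a)))"
        by simp
      \<comment> \<open>The unit ball of \<open>L_qH\<close> lies in the unit ball of each
        \<open>L_omit\<close>, so the same \<open>a\<close> is a test element for every
        summand.\<close>
      also have "\<dots> \<le> s"
        unfolding s dual_norm_def
      proof (intro sum_mono SUP_upper)
        fix i assume "i \<in> I"
        from qH_ge[OF this, of a] show "a \<in> {a \<in> carrier T. ?L i a \<le> 1}"
          using a by auto
      qed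
      finally show "ennreal (cmod (\<phi> a)) \<le> s" .
    qed
  qed

  \<comment> \<open>Existence of a decomposition with sum at most the quantum Hamming dual
    norm\<close>
  show "Inf ?S \<le> dual_norm T (L_qH I A T tens) \<phi>"
  proof (cases "dual_norm T (L_qH I A T tens) \<phi> = Orderings.top")
    case False
    define C where "C = enn2real (dual_norm T (L_qH I A T tens) \<phi>)"
    have C: "0 \<le> C" "dual_norm T (L_qH I A T tens) \<phi> = ennreal C"
      using False by (simp_all add: C_def less_top)
    have unit_ball: "cmod (\<phi> a) \<le> C" if "a \<in> carrier T" "L_qH I A T tens a \<le> 1" for a
    proof -
      have "ennreal (cmod (\<phi> a)) \<le> ennreal C"
        unfolding C(2)[symmetric] dual_norm_def using that by (intro SUP_upper) auto
      then show ?thesis using C(1) by simp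
    qed
    have \<phi>_le: "cmod (\<phi> a) \<le> C * L_qH I A T tens a" if "a \<in> carrier T" for a
      using T.linear_functional_le_seminorm[OF qH_seminorm \<phi> C(1) unit_ball that] .
    have "\<exists>\<phi>'. (\<forall>i\<in>I. \<phi>' i \<in> annihilator_omitting I A T tens i) \<and>
        (\<forall>a\<in>carrier T. \<phi> a = (\<Sum>i\<in>I. \<phi>' i a)) \<and>
        (\<Sum>i\<in>I. dual_norm T (?L i) (\<phi>' i)) \<le> ennreal C"
    proof (cases "I = {}")
      \<comment> \<open>For empty \<open>I\<close> the seminorm \<open>L_qH\<close> is 0, so
        \<open>\<phi>\<close> vanishes on the carrier and the empty sum represents it.\<close>
      case True
      then have "\<phi> a = 0" if "a \<in> carrier T" for a
        using \<phi>_le[OF that] by (simp add: L_qH_def)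
      then show ?thesis by (simp add: True)
    next
      case nonempty: False
      \<comment> \<open>The seminorms are nonnegative, so the inserted 0 does not change a maximum
        over a nonempty set.\<close>
      have qH_eq: "L_qH I A T tens a = (MAX i\<in>I. ?L i a)" if "a \<in> carrier T" for a
      proof -
        obtain k where "k \<in> I" using nonempty by blast
        then have "?L k a \<le> (MAX i\<in>I. ?L i a)" using I by (intro Max_ge) auto
        then have "0 \<le> (MAX i\<in>I. ?L i a)" using L_nonneg[OF that, of k] by simp
        then show ?thesis unfolding L_qH_def using I nonempty by (simp add: max_absorb2)
      qed
      have bound: "cmod (\<phi> a) \<le> C * (MAX i\<in>I. ?L i a)" if "a \<in> carrier T" for a
        using \<phi>_le[OF that] qH_eq[OF that] by simp
      obtain \<psi> where \<psi>: "\<And>i. i \<in> I \<Longrightarrow> T.linear_functional (\<psi> i)"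
        and \<psi>_sum: "\<And>a. a \<in> carrier T \<Longrightarrow> \<phi> a = (\<Sum>i\<in>I. \<psi> i a)"
        and \<psi>_le: "\<And>x. x \<in> I \<rightarrow> carrier T \<Longrightarrow>
          (\<Sum>i\<in>I. cmod (\<psi> i (x i))) \<le> C * (MAX i\<in>I. ?L i (x i))"
      proof (rule T.linear_functional_decomposition[OF I nonempty L \<phi> C(1) bound], goal_cases)
        case (2 \<psi>)
        from 2(2-4) show ?case by (rule 2(1))
      qed
      have \<psi>_le_L: "cmod (\<psi> i a) \<le> C * ?L i a" if i: "i \<in> I" and a: "a \<in> carrier T" for i a
      proof -
        \<comment> \<open>The tuple bound at a tuple supported in coordinate \<open>i\<close>: its
          other seminorms vanish, and the maximum is at most \<open>L_omit\<close> at
          \<open>a\<close>.\<close>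
        define x where "x j = (if j = i then a else \<zero>\<^bsub>T\<^esub>)" for j
        have "cmod (\<psi> i (x i)) \<le> (\<Sum>j\<in>I. cmod (\<psi> j (x j)))"
          using I i by (intro member_le_sum) auto
        also have "\<dots> \<le> C * (MAX j\<in>I. ?L j (x j))"
          using a by (intro \<psi>_le) (simp add: x_def)
        also have "\<dots> \<le> C * ?L i a"
          using I i C(1) L_nonneg[OF a]
          by (intro mult_left_mono Max.boundedI) (auto simp: x_def L_zero)
        finally show ?thesis by (simp add: x_def)
      qed
      have "\<psi> i \<in> annihilator_omitting I A T tens i" if i: "i \<in> I" for i
      proof -
        have zero: "\<psi> i c = 0" if c: "c \<in> ?N i" for c
        proof -
          have "c \<in> carrier T" using T.submoduleE(1)[OF N] c by blast
          then show ?thesis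
            using \<psi>_le_L[OF i] T.dist_eq_0[OF N _ c] by (fastforce simp: L_omit_def)
        qed
        \<comment> \<open>Membership in \<open>M0 T\<close> requires vanishing on scalar multiples
          of the unit, which follows once the unit is known to lie in the submodule.\<close>
        have "tens (\<lambda>i\<in>I. \<one>\<^bsub>A i\<^esub>) \<in> ?N i"
          unfolding tensor_omitting_def
        proof (rule T.closed_span_superset[OF omit_sub])
          have "(\<lambda>i\<in>I. \<one>\<^bsub>A i\<^esub>) \<in> (\<Pi>\<^sub>E i\<in>I. carrier (A i))"
            using assms(2)
            by (auto intro!: monoid.one_closed ring.is_monoid simp: unital_cstar_algebra_def)
          then show "tens (\<lambda>i\<in>I. \<one>\<^bsub>A i\<^esub>) \<in>
              {tens a |a. a \<in> (\<Pi>\<^sub>E j\<in>I. carrier (A j)) \<and> a i = \<one>\<^bsub>A i\<^esub>}"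
            using i by force
        qed
        then have one: "\<one>\<^bsub>T\<^esub> \<in> ?N i"
          using min_tensor_product_one[OF assms(2,3)] by simp
        \<comment> \<open>Comparison with the element zero of the submodule gives distance at most
          \<open>cnorm T a\<close>; the 2 is the factor in \<open>L_omit\<close>. This bound yields
          continuity.\<close>
        have "cmod (\<psi> i a) \<le> (2 * C) * cnorm T a" if a: "a \<in> carrier T" for a
        proof -
          have "C * ?L i a \<le> C * (2 * cnorm T a)"
            unfolding L_omit_def using C(1) T.dist_le_nrm[OF N a]
            by (intro mult_left_mono) auto
          with \<psi>_le_L[OF i a] show ?thesis by (simp add: algebra_simps)
        qed
        then have "continuous_map (norm_topology T (cnorm T)) euclidean (\<psi> i)"
          by (rule T.continuous_map_linear_functional[OF \<psi>[OF i]])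
        with \<psi>[OF i] zero one zero T.submoduleE(4)[OF N _ one] show ?thesis
          by (simp add: annihilator_omitting_def M0_def T.linear_functional_def)
      qed
      moreover have "(\<Sum>i\<in>I. dual_norm T (?L i) (\<psi> i)) \<le> ennreal C"
        unfolding dual_norm_def
      \<comment> \<open>Test elements for the separate dual norms form a tuple in the product of the
        unit balls, where the maximum in \<open>\<psi>_le\<close> is at most 1.\<close>
      proof (rule sum_SUP_le_ennreal[OF I])
        show "{a \<in> carrier T. ?L i a \<le> 1} \<noteq> {}" for i
          using L_zero[of i] by (auto intro!: exI[of _ "\<zero>\<^bsub>T\<^esub>"])
        fix x assume x: "x \<in> (\<Pi> i\<in>I. {a \<in> carrier T. ?L i a \<le> 1})"
        have "(\<Sum>i\<in>I. cmod (\<psi> i (x i))) \<le> C * (MAX i\<in>I. ?L i (x i))"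
          using x by (intro \<psi>_le) auto
        also have "\<dots> \<le> C * 1"
          using I nonempty x C(1) by (intro mult_left_mono Max.boundedI) auto
        finally show "(\<Sum>i\<in>I. ennreal (cmod (\<psi> i (x i)))) \<le> ennreal C"
          by (simp add: ennreal_leI)
      qed
      ultimately show ?thesis using \<psi>_sum by blast
    qed
    then obtain \<phi>' where "\<forall>i\<in>I. \<phi>' i \<in> annihilator_omitting I A T tens i"
        "\<forall>a\<in>carrier T. \<phi> a = (\<Sum>i\<in>I. \<phi>' i a)"
        "(\<Sum>i\<in>I. dual_norm T (?L i) (\<phi>' i)) \<le> ennreal C"
      by blast
    then show ?thesis
      unfolding C(2) by (intro Inf_lower2) auto
  qed simp
qed

end
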